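(* Let $p$ be one of the power indices $\mathrm{PGI}$, $\mathrm{DP}$, $\mathrm{Nuc}$ (defined on simple games), or $\mathrm{MSRI}$, $\mathrm{AWI}$, $\mathrm{ARI}$ (defined on weighted games). For each $\varepsilon>0$ there exists an integer $N(\varepsilon)$ such that for every game $v$ on $n\ge N(\varepsilon)$ players in the domain of $p$ and every player $1\le i\le n$, either $p_i(v)=1$ or $p_i(v)\le\frac12+\varepsilon$. For $p\in\{\mathrm{PGI},\mathrm{DP},\mathrm{Nuc},\mathrm{MSRI}\}$ one may even take $\varepsilon=0$ and $N=1$.
   Context: A simple game on $N=\{1,\dots,n\}$ is a surjective, monotone map $v\colon 2^N\to\{0,1\}$; weighted if $v(S)=1$ iff $\sum_{j\in S}w_j\ge q$ for some weights $w_j\ge0$ and quota $q>0$ (written $[q;w]$). Minimal winning coalitions, maximal losing coalitions, null players and dictators as usual (dictator: $v(\{i\})=1$ and all others null). $\mathrm{PGI}_i=m_i/\sum_j m_j$ with $m_j$ the number of minimal winning coalitions containing $j$; $\mathrm{DP}_i=d_i/\sum_j d_j$ with $d_j=\sum_{S\ni j\text{ min. winning}}1/|S|$. Nucleolus: with excess $e(S,x)=v(S)-\sum_{j\in S}x_j$ and $E(x)$ the vector of all $2^n$ excesses sorted decreasingly, $\mathrm{Nuc}(v)$ is the lexicographic minimizer of $E(x)$ over $x\in\mathbb{R}^n$ with $\sum_j x_j\le1$. $\mathrm{MSRI}_i(v)$ is the average of $w_i/\sum_j w_j$ over all integer representations $(q;w)$ of $v$ with minimal $\sum_j w_j$. With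 $P^w(v)=\{w\ge0:\sum w_j=1,\ w(S)\ge w(T)\ \forall S\text{ min. winning},T\text{ max. losing}\}$ and $P^r(v)=\{(q,w)\ge0:\sum w_j=1,q\le1,w(S)\ge q\ \forall S\text{ min. winning},w(T)\le q\ \forall T\text{ max. losing}\}$, $\mathrm{AWI}_i(v)$ and $\mathrm{ARI}_i(v)$ are the averages of $w_i$ over $P^w(v)$ resp. $P^r(v)$ with respect to Lebesgue measure on their affine hulls. *)

theory Defs
  imports "HOL-Analysis.Analysis" "HOL-Probability.Probability"
begin

text \<open>Players are 1..n. A game on n players is a predicate v on coalitions
  (v S means v(S) = 1); only subsets of {1..n} matter.\<close>

definition players :: "nat \<Rightarrow> nat set" where
  "players n = {1..n}"

definition simple_game :: "nat \<Rightarrow> (nat set \<Rightarrow> bool) \<Rightarrow> bool" where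
  "simple_game n v \<longleftrightarrow>
     (\<forall>S T. S \<subseteq> T \<and> T \<subseteq> players n \<and> v S \<longrightarrow> v T) \<and>
     (\<exists>S. S \<subseteq> players n \<and> v S) \<and> (\<exists>S. S \<subseteq> players n \<and> \<not> v S)"

definition weighted_game :: "nat \<Rightarrow> (nat set \<Rightarrow> bool) \<Rightarrow> bool" where
  "weighted_game n v \<longleftrightarrow> simple_game n v \<and>
     (\<exists>(q::real) (w::nat \<Rightarrow> real). q > 0 \<and> (\<forall>j\<in>players n. w j \<ge> 0) \<and>
        (\<forall>S. S \<subseteq> players n \<longrightarrow> (v S \<longleftrightarrow> (\<Sum>j\<in>S. w j) \<ge> q)))"

definition min_winning :: "nat \<Rightarrow> (nat set \<Rightarrow> bool) \<Rightarrow> nat set \<Rightarrow> bool" where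
  "min_winning n v S \<longleftrightarrow> S \<subseteq> players n \<and> v S \<and> (\<forall>T. T \<subset> S \<longrightarrow> \<not> v T)"

definition max_losing :: "nat \<Rightarrow> (nat set \<Rightarrow> bool) \<Rightarrow> nat set \<Rightarrow> bool" where
  "max_losing n v S \<longleftrightarrow> S \<subseteq> players n \<and> \<not> v S \<and>
     (\<forall>T. S \<subset> T \<and> T \<subseteq> players n \<longrightarrow> v T)"

definition mwc_count :: "nat \<Rightarrow> (nat set \<Rightarrow> bool) \<Rightarrow> nat \<Rightarrow> real" where
  "mwc_count n v j = real (card {S. min_winning n v S \<and> j \<in> S})"

definition PGI :: "nat \<Rightarrow> (nat set \<Rightarrow> bool) \<Rightarrow> nat \<Rightarrow> real" where
  "PGI n v i = mwc_count n v i / (\<Sum>j\<in>players n. mwc_count n v j)"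

definition dp_weight :: "nat \<Rightarrow> (nat set \<Rightarrow> bool) \<Rightarrow> nat \<Rightarrow> real" where
  "dp_weight n v j = (\<Sum>S\<in>{S. min_winning n v S \<and> j \<in> S}. 1 / real (card S))"

definition DP :: "nat \<Rightarrow> (nat set \<Rightarrow> bool) \<Rightarrow> nat \<Rightarrow> real" where
  "DP n v i = dp_weight n v i / (\<Sum>j\<in>players n. dp_weight n v j)"

definition excess :: "(nat set \<Rightarrow> bool) \<Rightarrow> nat set \<Rightarrow> (nat \<Rightarrow> real) \<Rightarrow> real" where
  "excess v S x = of_bool (v S) - (\<Sum>j\<in>S. x j)"

definition excess_vector :: "nat \<Rightarrow> (nat set \<Rightarrow> bool) \<Rightarrow> (nat \<Rightarrow> real) \<Rightarrow> real list" where
  "excess_vector n v x =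
     rev (sorted_list_of_multiset (image_mset (\<lambda>S. excess v S x) (mset_set (Pow (players n)))))"

definition allocation :: "nat \<Rightarrow> (nat \<Rightarrow> real) \<Rightarrow> bool" where
  "allocation n x \<longleftrightarrow> (\<forall>j. j \<notin> players n \<longrightarrow> x j = 0) \<and> (\<Sum>j\<in>players n. x j) \<le> 1"

definition is_nucleolus :: "nat \<Rightarrow> (nat set \<Rightarrow> bool) \<Rightarrow> (nat \<Rightarrow> real) \<Rightarrow> bool" where
  "is_nucleolus n v x \<longleftrightarrow> allocation n x \<and>
     (\<forall>y. allocation n y \<longrightarrow>
        (excess_vector n v y, excess_vector n v x) \<notin> lexord {(a, b). a < b})"

definition Nuc :: "nat \<Rightarrow> (nat set \<Rightarrow> bool) \<Rightarrow> nat \<Rightarrow> real" where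
  "Nuc n v = (THE x. is_nucleolus n v x)"

definition int_rep :: "nat \<Rightarrow> (nat set \<Rightarrow> bool) \<Rightarrow> nat \<times> (nat \<Rightarrow> nat) \<Rightarrow> bool" where
  "int_rep n v qw \<longleftrightarrow> (case qw of (q, w) \<Rightarrow> q > 0 \<and> (\<forall>j. j \<notin> players n \<longrightarrow> w j = 0) \<and>
     (\<forall>S. S \<subseteq> players n \<longrightarrow> (v S \<longleftrightarrow> (\<Sum>j\<in>S. w j) \<ge> q)))"

definition min_sum_reps :: "nat \<Rightarrow> (nat set \<Rightarrow> bool) \<Rightarrow> (nat \<times> (nat \<Rightarrow> nat)) set" where
  "min_sum_reps n v = {(q, w). int_rep n v (q, w) \<and>
     (\<forall>q' w'. int_rep n v (q', w') \<longrightarrow> (\<Sum>j\<in>players n. w j) \<le> (\<Sum>j\<in>players n. w' j))}"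

definition MSRI :: "nat \<Rightarrow> (nat set \<Rightarrow> bool) \<Rightarrow> nat \<Rightarrow> real" where
  "MSRI n v i = (\<Sum>(q, w)\<in>min_sum_reps n v. real (w i) / real (\<Sum>j\<in>players n. w j))
                / real (card (min_sum_reps n v))"

text \<open>Points of R^I are functions nat => real vanishing outside the finite index set I.
  The affine hull of P consists of all finite affine combinations of points of P.\<close>

definition aff_hull :: "(nat \<Rightarrow> real) set \<Rightarrow> (nat \<Rightarrow> real) set" where
  "aff_hull P = {y. \<exists>F u. finite F \<and> F \<subseteq> P \<and> F \<noteq> {} \<and> (\<Sum>p\<in>F. u p) = 1 \<and>
                        y = (\<lambda>j. \<Sum>p\<in>F. u p * p j)}"

definition lebesgue_k :: "nat \<Rightarrow> (nat \<Rightarrow> real) measure" where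
  "lebesgue_k k = PiM {..<k} (\<lambda>_. lborel)"

definition affine_param ::
  "(nat \<Rightarrow> real) set \<Rightarrow> nat \<Rightarrow> ((nat \<Rightarrow> real) \<Rightarrow> (nat \<Rightarrow> real)) \<Rightarrow> bool" where
  "affine_param P k g \<longleftrightarrow>
     (\<exists>a b. g = (\<lambda>t j. a j + (\<Sum>l<k. t l * b l j))) \<and>
     inj_on g (space (lebesgue_k k)) \<and>
     g ` space (lebesgue_k k) = aff_hull P"

text \<open>Average of f over P w.r.t. Lebesgue measure on the affine hull of P (computed via
  any affine parametrisation; the result does not depend on the choice).\<close>
definition poly_avg :: "(nat \<Rightarrow> real) set \<Rightarrow> ((nat \<Rightarrow> real) \<Rightarrow> real) \<Rightarrow> real" where
  "poly_avg P f = (let (k, g) = (SOME kg. affine_param P (fst kg) (snd kg));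
                       A = g -` P \<inter> space (lebesgue_k k)
                   in (\<integral>t. indicator A t * f (g t) \<partial>lebesgue_k k) / measure (lebesgue_k k) A)"

definition Pw :: "nat \<Rightarrow> (nat set \<Rightarrow> bool) \<Rightarrow> (nat \<Rightarrow> real) set" where
  "Pw n v = {w. (\<forall>j. j \<notin> players n \<longrightarrow> w j = 0) \<and> (\<forall>j\<in>players n. w j \<ge> 0) \<and>
                (\<Sum>j\<in>players n. w j) = 1 \<and>
                (\<forall>S T. min_winning n v S \<and> max_losing n v T \<longrightarrow>
                        (\<Sum>j\<in>S. w j) \<ge> (\<Sum>j\<in>T. w j))}"

text \<open>Points (q, w) of R^{n+1} are encoded as functions z with z 0 = q and z j = w_j (1 <= j <= n).\<close>
definition Pr :: "nat \<Rightarrow> (nat set \<Rightarrow> bool) \<Rightarrow> (nat \<Rightarrow> real) set" where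
  "Pr n v = {z. (\<forall>j. j > n \<longrightarrow> z j = 0) \<and> (\<forall>j\<le>n. z j \<ge> 0) \<and>
                (\<Sum>j\<in>players n. z j) = 1 \<and> z 0 \<le> 1 \<and>
                (\<forall>S. min_winning n v S \<longrightarrow> (\<Sum>j\<in>S. z j) \<ge> z 0) \<and>
                (\<forall>T. max_losing n v T \<longrightarrow> (\<Sum>j\<in>T. z j) \<le> z 0)}"

definition AWI :: "nat \<Rightarrow> (nat set \<Rightarrow> bool) \<Rightarrow> nat \<Rightarrow> real" where
  "AWI n v i = poly_avg (Pw n v) (\<lambda>w. w i)"

definition ARI :: "nat \<Rightarrow> (nat set \<Rightarrow> bool) \<Rightarrow> nat \<Rightarrow> real" where
  "ARI n v i = poly_avg (Pr n v) (\<lambda>z. z i)"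

end

theory Submission
  imports Defs "HOL-Library.Function_Algebras"
begin

text \<open>PGI and DP: if \<open>{i}\<close> is not winning, every minimal winning coalition containing \<open>i\<close> contains
  a further player, who receives the same contribution; if \<open>{i}\<close> is winning, it is the only minimal
  winning coalition containing \<open>i\<close>.

  MSRI: if \<open>w i\<close> exceeds the sum of the other weights, then \<open>w i\<close> (together with \<open>q\<close>, when \<open>i\<close> alone
  loses) can be lowered by one, unless \<open>i\<close> is a dictator.

  Nucleolus: if the maximal excess is positive, the nucleolus is efficient and nonnegative, and
  shifting weight from a player with more than \<open>1/2\<close> to the others would lower the maximal excess.
  If it is not positive, only veto players get a positive amount, and by uniqueness
  all of them get the same.

  AWI and ARI: let \<open>P\<close> be the polytope. The points of \<open>P\<close> with \<open>w i > 1/2 + \<epsilon>\<close> stay in \<open>P\<close> when dilated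
  by the factor \<open>1 / (1 - \<epsilon>)\<close> from the vertex \<open>w = unit_vec i\<close>; for the polytope of
  representations, from the point with \<open>w = unit_vec i\<close> and quota \<open>1\<close> or \<open>0\<close>, according to whether
  \<open>q \<ge> 1/2\<close>. Since \<open>P\<close> has full dimension at least \<open>n - 1\<close>, these points make up
  at most a fraction \<open>2 * (1 - \<epsilon>) ^ (n - 1)\<close> of the volume.\<close>

section \<open>Indices built from minimal winning coalitions: PGI and DP\<close>

lemma finite_players [simp]: "finite (players n)"
  by (simp add: players_def)

lemma card_players [simp]: "card (players n) = n"
  by (simp add: players_def)

lemma simple_game_mono:
  "simple_game n v \<Longrightarrow> S \<subseteq> T \<Longrightarrow> T \<subseteq> players n \<Longrightarrow> v S \<Longrightarrow> v T"
  unfolding simple_game_def by blast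

lemma simple_game_players: "simple_game n v \<Longrightarrow> v (players n)"
  unfolding simple_game_def by blast

lemma simple_game_empty: "simple_game n v \<Longrightarrow> \<not> v {}"
  unfolding simple_game_def by blast

lemma sum_le_complement:
  fixes z :: "'a \<Rightarrow> real"
  assumes "finite N" "\<And>j. j \<in> N \<Longrightarrow> z j \<ge> 0" "sum z N = 1" "S \<subseteq> N" "i \<in> N - S"
  shows "sum z S \<le> 1 - z i"
proof -
  have "sum z (insert i S) \<le> sum z N"
    using assms by (intro sum_mono2) auto
  then show ?thesis using assms finite_subset[of S N] by simp
qed

text \<open>Common form of PGI (\<open>\<phi> S = 1\<close>) and DP
  (\<open>\<phi> S = 1 / card S\<close>). By double counting, \<open>S\<close> adds
  \<open>card S * \<phi> S\<close> to the denominator. If \<open>{i}\<close> is not in the family,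
  each \<open>S\<close> containing \<open>i\<close> has a second member, so the total is at least
  twice \<open>d i\<close>. Otherwise \<open>{i}\<close> is the only set containing
  \<open>i\<close>, and by \<open>single\<close> any further set adds at least
  \<open>\<phi> {i}\<close>.\<close>

lemma antichain_share:
  fixes \<phi> :: "'a set \<Rightarrow> real"
  assumes fin: "finite N" "\<M> \<subseteq> Pow N" and "{} \<notin> \<M>"
    and antichain: "\<And>S T. S \<in> \<M> \<Longrightarrow> T \<in> \<M> \<Longrightarrow> S \<subseteq> T \<Longrightarrow> S = T"
    and pos: "\<And>S. S \<in> \<M> \<Longrightarrow> \<phi> S > 0"
    and single: "\<And>S. S \<in> \<M> \<Longrightarrow> \<phi> {i} \<le> real (card S) * \<phi> S"
  defines "d \<equiv> \<lambda>j. \<Sum>S\<in>{S\<in>\<M>. j \<in> S}. \<phi> S"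
  shows "d i / (\<Sum>j\<in>N. d j) = 1 \<or> d i / (\<Sum>j\<in>N. d j) \<le> 1/2"
proof -
  have finM: "finite \<M>"
    using fin finite_subset by blast
  have fin_mem: "finite S" "card S > 0" if "S \<in> \<M>" for S
    using that fin \<open>{} \<notin> \<M>\<close> finite_subset[of S N] by (auto simp: card_gt_0_iff)
  have "(\<Sum>j\<in>N. d j) = (\<Sum>j\<in>N. \<Sum>S\<in>\<M>. if j \<in> S then \<phi> S else 0)"
    unfolding d_def using finM by (simp add: sum.inter_filter)
  also have "\<dots> = (\<Sum>S\<in>\<M>. \<Sum>j\<in>N. if j \<in> S then \<phi> S else 0)"
    by (rule sum.swap)
  also have "\<dots> = (\<Sum>S\<in>\<M>. real (card S) * \<phi> S)"
  proof (rule sum.cong)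
    fix S assume "S \<in> \<M>"
    then have "{j \<in> N. j \<in> S} = S" using fin by auto
    then show "(\<Sum>j\<in>N. if j \<in> S then \<phi> S else 0) = real (card S) * \<phi> S"
      using fin(1) by (simp flip: sum.inter_filter)
  qed simp
  finally have total: "(\<Sum>j\<in>N. d j) = (\<Sum>S\<in>\<M>. real (card S) * \<phi> S)" .
  have nonneg: "real (card S) * \<phi> S \<ge> 0" if "S \<in> \<M>" for S
    using pos[OF that] by simp
  show ?thesis
  proof (cases "{i} \<in> \<M>")
    case False
    have "2 * d i = (\<Sum>S\<in>{S\<in>\<M>. i \<in> S}. 2 * \<phi> S)"
      by (simp add: d_def sum_distrib_left)
    also have "\<dots> \<le> (\<Sum>S\<in>{S\<in>\<M>. i \<in> S}. real (card S) * \<phi> S)"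
    proof (rule sum_mono)
      fix S assume S: "S \<in> {S\<in>\<M>. i \<in> S}"
      then have "card S \<noteq> 1" using False by (auto simp: card_1_singleton_iff)
      then have "2 \<le> real (card S)" using fin_mem[of S] S by auto
      then show "2 * \<phi> S \<le> real (card S) * \<phi> S"
        using pos[of S] S by (intro mult_right_mono) auto
    qed
    also have "\<dots> \<le> (\<Sum>S\<in>\<M>. real (card S) * \<phi> S)"
      using finM nonneg by (intro sum_mono2) auto
    finally have "2 * d i \<le> (\<Sum>j\<in>N. d j)" using total by simp
    moreover have "(\<Sum>j\<in>N. d j) \<ge> 0"
      using total nonneg by (simp add: sum_nonneg)
    \<comment> \<open>A vanishing total is harmless: the quotient is then 0 by the convention for
      division.\<close>
    ultimately have "d i / (\<Sum>j\<in>N. d j) \<le> 1/2"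
      by (cases "(\<Sum>j\<in>N. d j) = 0") (auto simp: field_simps)
    then show ?thesis ..
  next
    case True
    have "{S\<in>\<M>. i \<in> S} = {{i}}"
      using True antichain[OF True] by blast
    then have di: "d i = \<phi> {i}" by (simp add: d_def)
    have split: "(\<Sum>j\<in>N. d j) = \<phi> {i} + (\<Sum>S\<in>\<M> - {{i}}. real (card S) * \<phi> S)"
      using total sum.remove[OF finM True, of "\<lambda>S. real (card S) * \<phi> S"] by simp
    have p: "\<phi> {i} > 0" using pos True by blast
    show ?thesis
    proof (cases "\<M> - {{i}} = {}")
      case True
      then show ?thesis unfolding split True di using p by simp
    next
      case False
      then obtain S where S: "S \<in> \<M> - {{i}}" by blast
      then have "\<phi> {i} \<le> real (card S) * \<phi> S" using single by blast
      also have "\<dots> \<le> (\<Sum>S\<in>\<M> - {{i}}. real (card S) * \<phi> S)"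
        using S finM nonneg by (intro member_le_sum) auto
      finally show ?thesis using split di p by (auto simp: field_simps)
    qed
  qed
qed

lemma min_winning_antichain:
  "min_winning n v S \<Longrightarrow> min_winning n v T \<Longrightarrow> S \<subseteq> T \<Longrightarrow> S = T"
  unfolding min_winning_def by blast

lemma min_winning_card_pos:
  assumes "simple_game n v" "min_winning n v S"
  shows "card S > 0"
proof -
  have "finite S" using assms finite_subset[OF _ finite_players] by (auto simp: min_winning_def)
  moreover have "S \<noteq> {}" using assms simple_game_empty by (auto simp: min_winning_def)
  ultimately show ?thesis by (simp add: card_gt_0_iff)
qed

theorem PGI_bound:
  assumes "simple_game n v"
  shows "PGI n v i = 1 \<or> PGI n v i \<le> 1/2"
proof -
  have "{} \<notin> {S. min_winning n v S}"
    using simple_game_empty[OF assms] by (auto simp: min_winning_def)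
  moreover have "{S. min_winning n v S} \<subseteq> Pow (players n)"
    by (auto simp: min_winning_def)
  ultimately show ?thesis
    using antichain_share[where N = "players n" and \<M> = "{S. min_winning n v S}"
        and \<phi> = "\<lambda>_. 1" and i = i]
      min_winning_antichain[of n v] min_winning_card_pos[OF assms]
    by (simp add: PGI_def mwc_count_def Suc_le_eq)
qed

theorem DP_bound:
  assumes "simple_game n v"
  shows "DP n v i = 1 \<or> DP n v i \<le> 1/2"
proof -
  have "{} \<notin> {S. min_winning n v S}"
    using simple_game_empty[OF assms] by (auto simp: min_winning_def)
  moreover have "{S. min_winning n v S} \<subseteq> Pow (players n)"
    by (auto simp: min_winning_def)
  ultimately show ?thesis
    using antichain_share[where N = "players n" and \<M> = "{S. min_winning n v S}"
        and \<phi> = "\<lambda>S. 1 / real (card S)" and i = i]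
      min_winning_antichain[of n v] min_winning_card_pos[OF assms]
    by (simp add: DP_def dp_weight_def Suc_le_eq)
qed

section \<open>Minimum sum representations\<close>

text \<open>The two equivalences compare the old and the new winning test for coalitions without and
  with \<open>i\<close>; in both, \<open>S\<close> stands for the members other than
  \<open>i\<close>.\<close>

lemma int_rep_decrease:
  assumes rep: "int_rep n v (q, w)" and i: "i \<in> players n" and w: "w i > 0"
    and "\<And>S. S \<subseteq> players n - {i} \<Longrightarrow> q' \<le> sum w S \<longleftrightarrow> q \<le> sum w S"
    and "\<And>S. S \<subseteq> players n - {i} \<Longrightarrow> q' \<le> w i - 1 + sum w S \<longleftrightarrow> q \<le> w i + sum w S"
    and "q' > 0"
  shows "int_rep n v (q', w(i := w i - 1))"
    and "sum (w(i := w i - 1)) (players n) < sum w (players n)"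
proof -
  have *: "sum (w(i := w i - 1)) S = (if i \<in> S then w i - 1 + sum w (S - {i}) else sum w S)"
    "sum w S = (if i \<in> S then w i + sum w (S - {i}) else sum w S)"
    if "S \<subseteq> players n" for S
  proof -
    have f: "finite S" using that finite_subset[OF _ finite_players] by blast
    show "sum w S = (if i \<in> S then w i + sum w (S - {i}) else sum w S)"
      using sum.remove[OF f, of i w] by simp
    have "sum (w(i := w i - 1)) (S - {i}) = sum w (S - {i})"
      by (rule sum.cong) auto
    then show "sum (w(i := w i - 1)) S = (if i \<in> S then w i - 1 + sum w (S - {i}) else sum w S)"
      using sum.remove[OF f, of i "w(i := w i - 1)"] by (auto intro!: sum.cong)
  qed
  show "int_rep n v (q', w(i := w i - 1))"
    unfolding int_rep_def prod.case
  proof (intro conjI allI impI)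
    fix S assume S: "S \<subseteq> players n"
    have "v S \<longleftrightarrow> q \<le> sum w S" using rep S by (auto simp: int_rep_def)
    also have "\<dots> \<longleftrightarrow> q' \<le> sum (w(i := w i - 1)) S"
    proof (cases "i \<in> S")
      case True
      then show ?thesis
        using *[OF S] assms(5)[of "S - {i}"] S by auto
    next
      case False
      then show ?thesis
        using *[OF S] assms(4)[of S] S by auto
    qed
    finally show "v S \<longleftrightarrow> q' \<le> sum (w(i := w i - 1)) S" .
  next
    show "(w(i := w i - 1)) j = 0" if "j \<notin> players n" for j
      using rep i that by (auto simp: int_rep_def)
  qed fact
  show "sum (w(i := w i - 1)) (players n) < sum w (players n)"
    using *[of "players n"] i w by simp
qed

lemma min_sum_reps_minimal:
  assumes "(q, w) \<in> min_sum_reps n v" "int_rep n v (q', w')"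
  shows "sum w (players n) \<le> sum w' (players n)"
  using assms unfolding min_sum_reps_def by blast

lemma min_sum_rep_share:
  assumes v: "simple_game n v" and i: "i \<in> players n"
    and min: "(q, w) \<in> min_sum_reps n v"
    and nondict: "v {i} \<Longrightarrow> \<exists>S. S \<subseteq> players n - {i} \<and> v S"
  shows "2 * w i \<le> sum w (players n)"
proof (rule ccontr)
  assume neg: "\<not> 2 * w i \<le> sum w (players n)"
  have rep: "int_rep n v (q, w)" using min by (simp add: min_sum_reps_def)
  then have q: "q > 0" and rv: "\<And>S. S \<subseteq> players n \<Longrightarrow> v S \<longleftrightarrow> q \<le> sum w S"
    by (auto simp: int_rep_def)
  have split: "sum w (players n) = w i + sum w (players n - {i})"
    using i by (simp add: sum.remove)
  then have small: "sum w T < w i" if "T \<subseteq> players n - {i}" for T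
    using neg sum_mono2[OF _ that, of w] by simp
  have pos: "w i > 0" using small[of "{}"] by simp
  show False
  proof (cases "v {i}")
    case True
    then obtain S where S: "S \<subseteq> players n - {i}" "v S" using nondict by blast
    then have "q \<le> sum w S" using rv[of S] by auto
    \<comment> \<open>The quota is at most the weight of a coalition avoiding \<open>i\<close>,
      hence strictly below \<open>w i\<close>; so \<open>i\<close> still wins alone with weight
      \<open>w i - 1\<close> and the same quota.\<close>
    then have "q < w i" using small[OF S(1)] by simp
    then have "int_rep n v (q, w(i := w i - 1))" "sum (w(i := w i - 1)) (players n) < sum w (players n)"
      using int_rep_decrease[OF rep i pos, of q] q by auto
    then show False using min_sum_reps_minimal[OF min] by (meson not_le)
  next
    case False
    then have wi: "w i < q" using rv[of "{i}"] i by simp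
    \<comment> \<open>By integrality \<open>sum w T < w i < q\<close> gives
      \<open>sum w T < q - 1\<close>, so coalitions without \<open>i\<close> lose under either
      quota. For those with \<open>i\<close>, weight and quota drop together.\<close>
    have 1: "q - 1 \<le> sum w T \<longleftrightarrow> q \<le> sum w T" if "T \<subseteq> players n - {i}" for T
      using small[OF that] wi by linarith
    have 2: "q - 1 \<le> w i - 1 + sum w T \<longleftrightarrow> q \<le> w i + sum w T" for T
      using pos q by linarith
    have 3: "q - 1 > 0" using pos wi by linarith
    note int_rep_decrease[OF rep i pos 1 2 3]
    then show False using min_sum_reps_minimal[OF min] by (meson not_le)
  qed
qed

text \<open>Since \<open>{i}\<close> wins, every representation has
  \<open>1 \<le> q \<le> w i \<le> sum w (players n)\<close>. The unit weight attains total 1, which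
  leaves no freedom for any other minimal representation.\<close>

lemma min_sum_reps_dictator:
  assumes i: "i \<in> players n" and dict: "\<And>S. S \<subseteq> players n \<Longrightarrow> v S \<longleftrightarrow> i \<in> S"
  shows "min_sum_reps n v = {(1, \<lambda>j. if j = i then 1 else 0)}"
proof -
  let ?R = "{(1, \<lambda>j. if j = i then 1 else 0)} :: (nat \<times> (nat \<Rightarrow> nat)) set"
  let ?e = "\<lambda>j. if j = i then 1 else 0 :: nat"
  have sum_e: "sum ?e S = (if i \<in> S then 1 else 0)" if "S \<subseteq> players n" for S
    using finite_subset[OF that] by simp
  have rep_e: "int_rep n v (1, ?e)"
    using i dict by (auto simp: int_rep_def sum_e)
  have sum_ge: "1 \<le> q \<and> q \<le> w i \<and> w i \<le> sum w (players n)" if "int_rep n v (q, w)" for q w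
  proof -
    have "v {i} \<longleftrightarrow> q \<le> sum w {i}" "q > 0"
      using that i unfolding int_rep_def by blast+
    moreover have "v {i}" using dict[of "{i}"] i by simp
    ultimately show ?thesis using i by (auto intro: member_le_sum)
  qed
  show ?thesis
  proof (intro equalityI subsetI)
    fix qw assume qw: "qw \<in> min_sum_reps n v"
    obtain q w where [simp]: "qw = (q, w)" by fastforce
    have rep: "int_rep n v (q, w)" using qw by (simp add: min_sum_reps_def)
    have "sum w (players n) \<le> 1"
      using min_sum_reps_minimal[OF _ rep_e, of q w] qw sum_e[of "players n"] i by simp
    then have q: "q = 1" "w i = 1" "sum w (players n) = 1"
      using sum_ge[OF rep] by auto
    moreover have "w j = 0" if "j \<noteq> i" for j
    proof (cases "j \<in> players n")
      case True
      then have "sum w {i, j} \<le> sum w (players n)" using i by (intro sum_mono2) auto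
      then show ?thesis using that q by simp
    next
      case False
      then show ?thesis using rep by (simp add: int_rep_def)
    qed
    ultimately have "w = ?e" by auto
    with q show "qw \<in> ?R" by simp
  next
    fix qw assume "qw \<in> ?R"
    moreover have "sum ?e (players n) \<le> sum w' (players n)" if "int_rep n v (q', w')" for q' w'
      using sum_ge[OF that] sum_e[of "players n"] i by simp
    ultimately show "qw \<in> min_sum_reps n v"
      using rep_e by (auto simp: min_sum_reps_def)
  qed
qed

text \<open>If there is no minimal representation, or infinitely many of them, then division by zero
  gives the value 0; so neither existence nor finiteness is an issue.\<close>

theorem MSRI_bound:
  assumes v: "simple_game n v" and i: "i \<in> players n"
  shows "MSRI n v i = 1 \<or> MSRI n v i \<le> 1/2"
proof (cases "v {i} \<and> (\<forall>S. S \<subseteq> players n - {i} \<longrightarrow> \<not> v S)")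
  case True
  have "v S \<longleftrightarrow> i \<in> S" if "S \<subseteq> players n" for S
    using True that simple_game_mono[OF v, of "{i}" S] by blast
  then have "min_sum_reps n v = {(1, \<lambda>j. if j = i then 1 else 0)}"
    by (intro min_sum_reps_dictator i)
  moreover have "(\<Sum>j\<in>players n. if j = i then 1 else 0) = (1::nat)" using i by simp
  ultimately show ?thesis by (simp add: MSRI_def del: of_nat_sum)
next
  case False
  let ?M = "min_sum_reps n v"
  have "(\<Sum>(q, w)\<in>?M. real (w i) / real (\<Sum>j\<in>players n. w j)) \<le> (\<Sum>qw\<in>?M. 1/2)"
  proof (rule sum_mono, clarify)
    fix q w assume "(q, w) \<in> ?M"
    then have "2 * w i \<le> sum w (players n)"
      using False min_sum_rep_share[OF v i] by blast
    then have "2 * real (w i) \<le> real (sum w (players n))"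
      by linarith
    then show "real (w i) / real (\<Sum>j\<in>players n. w j) \<le> 1/2"
      by (cases "sum w (players n) = 0") (auto simp: divide_simps)
  qed
  also have "\<dots> = 1/2 * card ?M" by simp
  finally have "MSRI n v i \<le> 1/2"
    unfolding MSRI_def by (cases "card ?M = 0") (auto simp: field_simps)
  then show ?thesis ..
qed

section \<open>The nucleolus\<close>

text \<open>If the infimum were not attained, the open sets where \<open>f\<close> exceeds
  \<open>f y\<close>, for \<open>y\<close> in \<open>K\<close>, would cover \<open>K\<close>. In a
  finite subcover, the point \<open>y\<close> with the least value is left uncovered.\<close>

lemma lsc_attains_inf_compact:
  fixes f :: "'a::topological_space \<Rightarrow> 'b::linorder"
  assumes K: "compact K" "K \<noteq> {}" and lsc: "\<And>c. closed {x. f x \<le> c}"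
  shows "\<exists>x\<in>K. \<forall>y\<in>K. f x \<le> f y"
proof (rule ccontr)
  assume "\<not> ?thesis"
  then have *: "\<And>x. x \<in> K \<Longrightarrow> \<exists>y\<in>K. f y < f x" by (auto simp: not_le)
  have "K \<subseteq> (\<Union>y\<in>K. - {x. f x \<le> f y})"
    using * by (fastforce simp: not_le)
  moreover have "\<And>y. y \<in> K \<Longrightarrow> open (- {x. f x \<le> f y})"
    using lsc by (simp add: open_Compl)
  ultimately obtain D where D: "D \<subseteq> K" "finite D" "K \<subseteq> (\<Union>y\<in>D. - {x. f x \<le> f y})"
    using compactE_image[OF K(1)] by metis
  then have "D \<noteq> {}" using K by auto
  then obtain y where y: "y \<in> D" "\<And>z. z \<in> D \<Longrightarrow> f y \<le> f z"
    using ex_min_if_finite[of "f ` D"] D(2) by (auto simp: not_less)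
  then obtain z where "z \<in> D" "\<not> f y \<le> f z" using D by blast
  then show False using y by blast
qed

section \<open>Lexicographic minimisation\<close>

abbreviation lex_less :: "real list \<Rightarrow> real list \<Rightarrow> bool" where
  "lex_less xs ys \<equiv> (xs, ys) \<in> lexord {(a, b). a < b}"

lemma lex_less_trans: "lex_less xs ys \<Longrightarrow> lex_less ys zs \<Longrightarrow> lex_less xs zs"
  by (rule lexord_trans) (auto intro: transI)

lemma lex_less_irrefl: "\<not> lex_less xs xs"
  by (rule lexord_irreflexive) auto

lemma lex_less_linear: "lex_less xs ys \<or> xs = ys \<or> lex_less ys xs"
  by (rule lexord_linear) auto

text \<open>Coordinates are minimised one after the other. Each step intersects the current compact
  set of minimisers with a closed sublevel set of the next coordinate, so lower semicontinuity
  suffices.\<close>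

lemma exists_lex_minimizer:
  fixes F :: "'a::topological_space \<Rightarrow> real list"
  assumes X: "compact X" "X \<noteq> {}" and len: "\<And>x. length (F x) = m"
    and lsc: "\<And>k c. k < m \<Longrightarrow> closed {x. F x ! k \<le> c}"
  shows "\<exists>x\<in>X. \<forall>y\<in>X. \<not> lex_less (F y) (F x)"
proof -
  \<comment> \<open>Invariant: \<open>p\<close> is the optimal prefix of length \<open>k\<close>,
    and \<open>K\<close> consists of exactly the points of \<open>X\<close> that attain it.\<close>
  have "\<exists>K p. K \<noteq> {} \<and> compact K \<and> K \<subseteq> X \<and> (\<forall>x\<in>K. take k (F x) = p) \<and>
      (\<forall>y\<in>X - K. lex_less p (take k (F y)))" if "k \<le> m" for k
    using that
  proof (induction k)
    case 0
    then show ?case using X by auto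
  next
    case (Suc k)
    then obtain K p where K: "K \<noteq> {}" "compact K" "K \<subseteq> X"
      and p: "\<And>x. x \<in> K \<Longrightarrow> take k (F x) = p" "\<And>y. y \<in> X - K \<Longrightarrow> lex_less p (take k (F y))"
      by (metis Suc_leD)
    have k: "k < m" using Suc by simp
    have takeS: "take (Suc k) (F x) = take k (F x) @ [F x ! k]" for x
      using k len by (simp add: take_Suc_conv_app_nth)
    let ?f = "\<lambda>x. F x ! k"
    have "\<exists>x\<in>K. \<forall>y\<in>K. ?f x \<le> ?f y"
      using K lsc[OF k] by (intro lsc_attains_inf_compact)
    then obtain x0 where x0: "x0 \<in> K" "\<And>y. y \<in> K \<Longrightarrow> ?f x0 \<le> ?f y" by blast
    let ?K = "K \<inter> {x. ?f x \<le> ?f x0}"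
    have "?K \<noteq> {}" "?K \<subseteq> X" using x0 K by auto
    moreover have "compact ?K" using K lsc[OF k] by (intro compact_Int_closed)
    moreover have "\<forall>x\<in>?K. take (Suc k) (F x) = p @ [?f x0]"
      using x0 p by (auto simp: takeS intro: antisym)
    moreover have "\<forall>y\<in>X - ?K. lex_less (p @ [?f x0]) (take (Suc k) (F y))"
    proof
      fix y assume y: "y \<in> X - ?K"
      show "lex_less (p @ [?f x0]) (take (Suc k) (F y))"
      proof (cases "y \<in> K")
        case True
        then have "?f x0 < ?f y" using y by auto
        then show ?thesis using p(1)[OF True] by (simp add: takeS lexord_append_leftI)
      next
        case False
        then have "lex_less p (take k (F y))" using p(2) y by blast
        moreover have "length p = length (take k (F y))"
          using p(1)[OF x0(1)] len k by auto
        ultimately show ?thesis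
          unfolding takeS by (intro lexord_sufI) auto
      qed
    qed
    ultimately show ?case
      by (intro exI[of _ ?K] exI[of _ "p @ [?f x0]"] conjI)
  qed
  from this[OF order_refl] obtain K p where K: "K \<noteq> {}" "K \<subseteq> X" "\<forall>x\<in>K. take m (F x) = p"
    "\<forall>y\<in>X - K. lex_less p (take m (F y))"
    by blast
  then obtain x where x: "x \<in> K" by blast
  have "\<not> lex_less (F y) (F x)" if "y \<in> X" for y
    using K(3,4) x that len lex_less_irrefl lex_less_trans[of p "F y" p]
    by (cases "y \<in> K") auto
  then show ?thesis using x K(2) by blast
qed

text \<open>In a decreasing list the entries above \<open>c\<close> form an initial segment.
  Counting them describes sublevel sets of a sorted entry without mentioning the sorting.\<close>

lemma sorted_nth_le_iff:
  fixes xs :: "'a::linorder list"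
  assumes "sorted (rev xs)" "k < length xs"
  shows "xs ! k \<le> c \<longleftrightarrow> length (filter (\<lambda>a. c < a) xs) \<le> k"
proof -
  have anti: "xs ! j \<le> xs ! i" if "i \<le> j" "j < length xs" for i j
    using sorted_rev_nth_mono[OF assms(1) that] .
  show ?thesis
  proof
    assume le: "xs ! k \<le> c"
    have "{j. j < length xs \<and> c < xs ! j} \<subseteq> {..<k}"
      using le anti[of k] by (force simp: not_less[symmetric])
    then have "card {j. j < length xs \<and> c < xs ! j} \<le> k"
      using card_mono[of "{..<k}"] by fastforce
    then show "length (filter (\<lambda>a. c < a) xs) \<le> k" by (simp add: length_filter_conv_card)
  next
    assume len: "length (filter (\<lambda>a. c < a) xs) \<le> k"
    show "xs ! k \<le> c"
    proof (rule ccontr)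
      assume "\<not> xs ! k \<le> c"
      then have "{..k} \<subseteq> {j. j < length xs \<and> c < xs ! j}"
        using assms(2) anti[of _ k] by (fastforce simp: not_le intro: less_le_trans)
      then have "Suc k \<le> card {j. j < length xs \<and> c < xs ! j}"
        using card_mono[of "{j. j < length xs \<and> c < xs ! j}" "{..k}"] by simp
      with len show False by (simp add: length_filter_conv_card)
    qed
  qed
qed

text \<open>At the first difference \<open>a < b\<close>, all later entries of \<open>xs\<close> are
  at most \<open>a\<close>, because \<open>xs\<close> decreases. For large \<open>t\<close> the
  single term \<open>exp (t * b)\<close> outweighs them all.\<close>

lemma lex_less_sum_exp:
  fixes xs ys :: "real list"
  assumes len: "length xs = length ys" and sorted: "sorted (rev xs)" and less: "lex_less xs ys"
  shows "\<exists>t>0. (\<Sum>a\<leftarrow>xs. exp (t * a)) < (\<Sum>b\<leftarrow>ys. exp (t * b))"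
proof -
  obtain u a b as bs where ab: "a < b" "xs = u @ a # as" "ys = u @ b # bs"
    using less len by (auto simp: lexord_def)
  have tail: "x \<le> a" if "x \<in> set as" for x
    using sorted ab(2) that by (auto simp: sorted_append)
  define m where "m = real (Suc (length as))"
  \<comment> \<open>Chosen so that \<open>t * (b - a)\<close> exceeds \<open>ln m\<close>, that is,
    \<open>m * exp (t * a) < exp (t * b)\<close>.\<close>
  define t where "t = (ln m + 1) / (b - a)"
  have m: "m \<ge> 1" by (simp add: m_def)
  then have "ln m \<ge> 0" by simp
  then have t: "t > 0" using ab by (simp add: t_def)
  have "(\<Sum>x\<leftarrow>a # as. exp (t * x)) \<le> (\<Sum>x\<leftarrow>a # as. exp (t * a))"
    using tail t by (intro sum_list_mono) auto
  also have "\<dots> = m * exp (t * a)" by (simp add: m_def sum_list_triv algebra_simps)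
  also have "\<dots> = exp (ln m + t * a)" using m by (simp add: exp_add)
  also have "\<dots> < exp (t * b)"
  proof -
    have "t * (b - a) = ln m + 1" using ab by (simp add: t_def)
    then show ?thesis by (simp add: algebra_simps)
  qed
  also have "\<dots> \<le> (\<Sum>x\<leftarrow>b # bs. exp (t * x))"
    by (auto intro!: sum_list_nonneg)
  finally show ?thesis using t by (auto simp: ab intro!: exI[of _ t])
qed

section \<open>Existence and uniqueness of the nucleolus\<close>

context
  fixes n :: nat and v :: "nat set \<Rightarrow> bool"
begin

lemma mset_excess_vector:
  "mset (excess_vector n v x) = image_mset (\<lambda>S. excess v S x) (mset_set (Pow (players n)))"
  by (simp add: excess_vector_def)

lemma length_excess_vector: "length (excess_vector n v x) = card (Pow (players n))"
  using arg_cong[OF mset_excess_vector, of size] by simp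

lemma sorted_excess_vector: "sorted (rev (excess_vector n v x))"
  by (simp add: excess_vector_def)

lemma sum_excess_vector:
  "(\<Sum>a\<leftarrow>excess_vector n v x. f a) = (\<Sum>S\<in>Pow (players n). f (excess v S x))"
proof -
  have "(\<Sum>a\<leftarrow>excess_vector n v x. f a) = \<Sum>\<^sub># (image_mset f (mset (excess_vector n v x)))"
    by (metis mset_map sum_mset_sum_list)
  then show ?thesis
    by (simp add: mset_excess_vector multiset.map_comp comp_def sum_unfold_sum_mset)
qed

lemma excess_vector_nth_le_iff:
  assumes "k < card (Pow (players n))"
  shows "excess_vector n v x ! k \<le> c \<longleftrightarrow> card {S \<in> Pow (players n). c < excess v S x} \<le> k"
proof -
  have "length (filter (\<lambda>a. c < a) (excess_vector n v x)) =
      size (filter_mset (\<lambda>a. c < a) (mset (excess_vector n v x)))"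
    by (metis mset_filter size_mset)
  also have "\<dots> = card {S \<in> Pow (players n). c < excess v S x}"
    by (simp add: mset_excess_vector filter_mset_image_mset)
  finally show ?thesis
    using sorted_nth_le_iff[OF sorted_excess_vector] assms length_excess_vector by simp
qed

lemma continuous_on_excess: "continuous_on UNIV (excess v S)"
  unfolding excess_def by (intro continuous_intros continuous_on_product_coordinates)

text \<open>Entry \<open>k\<close> (counted from 0) exceeds \<open>c\<close> iff more than
  \<open>k\<close> coalitions have excess above \<open>c\<close>. This is a union, over families of
  more than \<open>k\<close> coalitions, of finite intersections of open half-spaces.\<close>

lemma closed_excess_vector_nth_le:
  assumes "k < card (Pow (players n))"
  shows "closed {x. excess_vector n v x ! k \<le> c}"
proof -
  let ?N = "Pow (players n)"
  have "- {x. excess_vector n v x ! k \<le> c} =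
      (\<Union>\<T>\<in>{\<T>. \<T> \<subseteq> ?N \<and> k < card \<T>}. \<Inter>S\<in>\<T>. {x. c < excess v S x})"
  proof (intro equalityI subsetI)
    fix x assume "x \<in> - {x. excess_vector n v x ! k \<le> c}"
    then show "x \<in> (\<Union>\<T>\<in>{\<T>. \<T> \<subseteq> ?N \<and> k < card \<T>}. \<Inter>S\<in>\<T>. {x. c < excess v S x})"
      using excess_vector_nth_le_iff[OF assms, of x c]
      by (intro UN_I[of "{S \<in> ?N. c < excess v S x}"]) auto
  next
    fix x assume "x \<in> (\<Union>\<T>\<in>{\<T>. \<T> \<subseteq> ?N \<and> k < card \<T>}. \<Inter>S\<in>\<T>. {x. c < excess v S x})"
    then obtain \<T> where \<T>: "\<T> \<subseteq> ?N" "k < card \<T>" "\<And>S. S \<in> \<T> \<Longrightarrow> c < excess v S x" by blast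
    have "card \<T> \<le> card {S \<in> ?N. c < excess v S x}"
      using \<T> by (intro card_mono) auto
    then show "x \<in> - {x. excess_vector n v x ! k \<le> c}"
      using \<T> excess_vector_nth_le_iff[OF assms, of x c] by simp
  qed
  moreover have "open (\<Union>\<T>\<in>{\<T>. \<T> \<subseteq> ?N \<and> k < card \<T>}. \<Inter>S\<in>\<T>. {x. c < excess v S x})"
  proof (intro open_UN ballI open_INT)
    show "finite \<T>" if "\<T> \<in> {\<T>. \<T> \<subseteq> ?N \<and> k < card \<T>}" for \<T>
      using that finite_subset[of \<T> ?N] by simp
    show "open {x. c < excess v S x}" for S
      using continuous_on_excess by (intro open_Collect_less continuous_on_const)
  qed
  ultimately show ?thesis by (simp add: closed_def)
qed

text \<open>The head of an excess vector is the largest excess, so lowering the maximum already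
  decides the lexicographic comparison.\<close>

lemma lex_less_of_max_excess:
  assumes T: "T \<subseteq> players n" and less: "\<And>S. S \<subseteq> players n \<Longrightarrow> excess v S y < excess v T x"
  shows "lex_less (excess_vector n v y) (excess_vector n v x)"
proof -
  have pos: "0 < card (Pow (players n))" by (simp add: card_Pow)
  let ?c = "excess_vector n v x ! 0"
  have "card {S \<in> Pow (players n). ?c < excess v S x} = 0"
    using excess_vector_nth_le_iff[OF pos, of x ?c] by simp
  then have xT: "excess v T x \<le> ?c" using T by (auto simp: not_less[symmetric])
  have "excess_vector n v y ! 0 \<in> set (excess_vector n v y)"
    using length_excess_vector pos by (metis nth_mem)
  then have "excess_vector n v y ! 0 \<in># mset (excess_vector n v y)" by simp
  then obtain S where "S \<subseteq> players n" "excess_vector n v y ! 0 = excess v S y"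
    unfolding mset_excess_vector by auto
  then have "excess_vector n v y ! 0 < ?c"
    using less[of S] xT by simp
  then show ?thesis
    using length_excess_vector[of x] length_excess_vector[of y] pos
    by (cases "excess_vector n v x"; cases "excess_vector n v y") auto
qed

text \<open>Tychonoff: the coordinates outside \<open>N\<close> are pinned to 0, so every factor of
  the product is compact.\<close>

lemma compact_box: "compact {x :: nat \<Rightarrow> real. \<forall>j. x j \<in> (if j \<in> N then {a..b} else {0})}"
proof -
  have "compactin (product_topology (\<lambda>j. euclidean) UNIV)
      (PiE UNIV (\<lambda>j. if j \<in> N then {a..b} else {0::real}))"
    unfolding compactin_PiE by auto
  then show ?thesis
    unfolding euclidean_product_topology by (simp add: PiE_def Pi_def)
qed

text \<open>Allocations are unbounded, but one with \<open>y j < -1\<close> has an excess above 1 at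
  \<open>{j}\<close> and loses to the zero allocation. If all coordinates are at least -1, the bound
  on the sum keeps them below \<open>1 + n\<close>, so a minimiser on a compact box is a global
  one.\<close>

lemma is_nucleolus_exists: "\<exists>x. is_nucleolus n v x"
proof -
  let ?N = "players n" and ?E = "excess_vector n v"
  let ?X = "{x. \<forall>j. x j \<in> (if j \<in> ?N then {-1..1 + real n} else {0})} \<inter> {x. (\<Sum>j\<in>?N. x j) \<le> 1}"
  have "closed {x :: nat \<Rightarrow> real. (\<Sum>j\<in>?N. x j) \<le> 1}"
    by (intro closed_Collect_le continuous_intros continuous_on_product_coordinates)
  then have "compact ?X" using compact_box by (intro compact_Int_closed)
  moreover have zero: "(\<lambda>_. 0) \<in> ?X" by simp
  then have "?X \<noteq> {}" by (rule ex_in_conv[THEN iffD1, OF exI])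
  ultimately have "\<exists>x\<in>?X. \<forall>y\<in>?X. \<not> lex_less (?E y) (?E x)"
    using length_excess_vector closed_excess_vector_nth_le by (rule exists_lex_minimizer)
  then obtain x where x: "x \<in> ?X" "\<forall>y\<in>?X. \<not> lex_less (?E y) (?E x)" ..
  have "\<not> lex_less (?E y) (?E x)" if y: "allocation n y" for y
  proof (cases "\<forall>j\<in>?N. -1 \<le> y j")
    case True
    have "y j \<le> 1 + real n" if j: "j \<in> ?N" for j
    proof -
      have "- real (card (?N - {j})) \<le> sum y (?N - {j})"
        using sum_mono[of "?N - {j}" "\<lambda>_. -1" y] True by simp
      moreover have "card (?N - {j}) \<le> n" using j by simp
      ultimately show ?thesis
        using y sum.remove[OF finite_players j, of y] by (auto simp: allocation_def)
    qed
    then have "y \<in> ?X" using True y by (auto simp: allocation_def)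
    then show ?thesis using x by blast
  next
    case False
    then obtain j where j: "j \<in> ?N" "y j < -1" by auto
    have "lex_less (?E (\<lambda>_. 0)) (?E y)"
    proof (rule lex_less_of_max_excess[of "{j}"])
      show "excess v S (\<lambda>_. 0) < excess v {j} y" for S
        using j by (auto simp: excess_def)
    qed (use j in simp)
    moreover have "\<not> lex_less (?E (\<lambda>_. 0)) (?E x)" using x zero by blast
    ultimately show ?thesis using lex_less_trans by blast
  qed
  moreover have "x j = 0" if "j \<notin> ?N" for j
  proof -
    have "x j \<in> (if j \<in> ?N then {-1..1 + real n} else {0})" using x(1) by blast
    then show ?thesis using that by simp
  qed
  then have "allocation n x" using x(1) by (auto simp: allocation_def)
  ultimately show ?thesis by (auto simp: is_nucleolus_def)
qed

lemma exp_midpoint_le: "exp ((a + b) / 2) \<le> (exp a + exp b) / (2::real)"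
  and exp_midpoint_less: "a \<noteq> b \<Longrightarrow> exp ((a + b) / 2) < (exp a + exp b) / (2::real)"
proof -
  have "(exp (a / 2) - exp (b / 2))\<^sup>2 = exp a + exp b - 2 * exp ((a + b) / 2)"
    by (simp add: power2_diff add_divide_distrib mult.assoc flip: exp_add exp_double)
  moreover have "(exp (a / 2) - exp (b / 2))\<^sup>2 \<ge> 0" by simp
  moreover have "a \<noteq> b \<Longrightarrow> (exp (a / 2) - exp (b / 2))\<^sup>2 > 0" by simp
  ultimately show "exp ((a + b) / 2) \<le> (exp a + exp b) / 2"
    and "a \<noteq> b \<Longrightarrow> exp ((a + b) / 2) < (exp a + exp b) / 2" by simp_all
qed

text \<open>The strictly convex functions \<open>\<Sum>S. exp (t * excess v S x)\<close>, as \<open>t\<close> grows, detect the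
  lexicographic order, so two distinct minimizers would be beaten by their midpoint.\<close>

lemma is_nucleolus_unique:
  assumes x: "is_nucleolus n v x" and y: "is_nucleolus n v y"
  shows "x = y"
proof (rule ccontr)
  assume "x \<noteq> y"
  let ?E = "excess_vector n v"
  have alloc: "allocation n x" "allocation n y" using x y by (auto simp: is_nucleolus_def)
  obtain j where "x j \<noteq> y j" using \<open>x \<noteq> y\<close> by auto
  then have j: "j \<in> players n" using alloc by (metis allocation_def)
  define z where "z j = (x j + y j) / 2" for j
  have exc: "excess v S z = (excess v S x + excess v S y) / 2" for S
    by (simp add: excess_def z_def sum.distrib field_simps flip: sum_divide_distrib)
  have "allocation n z"
    using alloc by (simp add: allocation_def z_def sum.distrib flip: sum_divide_distrib)
  then have "\<not> lex_less (?E z) (?E x)" using x by (auto simp: is_nucleolus_def)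
  then have "?E z = ?E x \<or> lex_less (?E x) (?E z)" using lex_less_linear by blast
  \<comment> \<open>The midpoint \<open>z\<close> does not beat \<open>x\<close>, so some
    exponential sum does not decrease from \<open>x\<close> to \<open>z\<close>; strict convexity
    will contradict this.\<close>
  then obtain t where t: "t > 0" "(\<Sum>a\<leftarrow>?E x. exp (t * a)) \<le> (\<Sum>a\<leftarrow>?E z. exp (t * a))"
  proof
    assume "?E z = ?E x"
    then show thesis using that[of 1] by simp
  next
    assume "lex_less (?E x) (?E z)"
    then show thesis
      using lex_less_sum_exp[OF _ sorted_excess_vector] length_excess_vector that
      by (metis less_imp_le)
  qed
  have "\<not> lex_less (?E x) (?E y)" "\<not> lex_less (?E y) (?E x)"
    using x y alloc by (auto simp: is_nucleolus_def)
  then have "?E x = ?E y" using lex_less_linear by blast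
  then have xy: "(\<Sum>S\<in>Pow (players n). exp (t * excess v S x)) = (\<Sum>S\<in>Pow (players n). exp (t * excess v S y))"
    using sum_excess_vector[of "\<lambda>a. exp (t * a)"] by metis
  have tz: "t * excess v S z = (t * excess v S x + t * excess v S y) / 2" for S
    by (simp add: exc algebra_simps)
  have "(\<Sum>S\<in>Pow (players n). exp (t * excess v S z)) <
      (\<Sum>S\<in>Pow (players n). (exp (t * excess v S x) + exp (t * excess v S y)) / 2)"
  proof (rule sum_strict_mono_ex1)
    show "\<forall>S\<in>Pow (players n). exp (t * excess v S z) \<le> (exp (t * excess v S x) + exp (t * excess v S y)) / 2"
      unfolding tz using exp_midpoint_le by blast
    \<comment> \<open>The singleton \<open>{j}\<close> makes one of the midpoint inequalities
      strict.\<close>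
    have "t * excess v {j} x \<noteq> t * excess v {j} y" using \<open>x j \<noteq> y j\<close> t by (simp add: excess_def)
    then show "\<exists>S\<in>Pow (players n). exp (t * excess v S z) < (exp (t * excess v S x) + exp (t * excess v S y)) / 2"
      unfolding tz using j exp_midpoint_less by (intro bexI[of _ "{j}"]) auto
  qed simp
  also have "\<dots> = (\<Sum>S\<in>Pow (players n). exp (t * excess v S x))"
    using xy by (simp add: sum.distrib flip: sum_divide_distrib)
  finally show False using t(2) by (simp add: sum_excess_vector)
qed

lemma is_nucleolus_Nuc: "is_nucleolus n v (Nuc n v)"
proof -
  obtain x where x: "is_nucleolus n v x" using is_nucleolus_exists by blast
  show ?thesis
    unfolding Nuc_def using theI[of "is_nucleolus n v" x] x is_nucleolus_unique by blast
qed

section \<open>First-order conditions and symmetry of the nucleolus\<close>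

lemma nucleolus_max_excess:
  assumes "is_nucleolus n v x" "allocation n y" "T \<subseteq> players n"
  shows "\<exists>S\<subseteq>players n. excess v T x \<le> excess v S y"
proof (rule ccontr)
  assume "\<not> ?thesis"
  then have "excess v S y < excess v T x" if "S \<subseteq> players n" for S
    using that not_le by blast
  then have "lex_less (excess_vector n v y) (excess_vector n v x)"
    using lex_less_of_max_excess[OF assms(3)] by blast
  then show False using assms(1,2) by (simp add: is_nucleolus_def)
qed

text \<open>If \<open>d\<close> gave positive weight to every coalition of maximal excess, a small
  step along \<open>d\<close> would lower all these excesses, while the others stay below the
  maximum by continuity. The condition on \<open>d\<close> keeps the step feasible.\<close>

lemma nucleolus_direction:
  fixes d :: "nat \<Rightarrow> real"
  assumes x: "is_nucleolus n v x" and T: "T \<subseteq> players n"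
    and max: "\<And>S. S \<subseteq> players n \<Longrightarrow> excess v S x \<le> excess v T x"
    and d: "sum d (players n) \<le> 0 \<or> sum x (players n) < 1"
  shows "\<exists>S\<subseteq>players n. excess v S x = excess v T x \<and> sum d S \<le> 0"
proof (rule ccontr)
  assume "\<not> ?thesis"
  then have incr: "sum d S > 0" if "S \<subseteq> players n" "excess v S x = excess v T x" for S
    using that by (meson not_le)
  let ?d = "\<lambda>j. if j \<in> players n then d j else 0"
  define y where "y \<delta> j = x j + \<delta> * ?d j" for \<delta> j
  have alloc: "allocation n x" using x by (simp add: is_nucleolus_def)
  have sum_y: "sum (y \<delta>) S = sum x S + \<delta> * sum d S" if "S \<subseteq> players n" for \<delta> S
  proof -
    have "sum ?d S = sum d S" using that by (intro sum.cong) auto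
    then show ?thesis by (simp add: y_def sum.distrib flip: sum_distrib_left)
  qed
  have "\<forall>\<^sub>F \<delta> in at_right 0. excess v S (y \<delta>) < excess v T x" if S: "S \<in> Pow (players n)" for S
  proof (cases "excess v S x = excess v T x")
    case True
    have "\<forall>\<^sub>F \<delta> in at_right (0::real). \<delta> > 0" by (rule eventually_at_right_less)
    then show ?thesis
    proof eventually_elim
      case (elim \<delta>)
      then have "\<delta> * sum d S > 0" using incr True S by simp
      then show ?case using True S by (simp add: excess_def sum_y)
    qed
  next
    case False
    have "((\<lambda>\<delta>. excess v S x - \<delta> * sum d S) \<longlongrightarrow> excess v S x - 0 * sum d S) (at_right 0)"
      by (intro tendsto_intros)
    moreover have "excess v S x < excess v T x" using False max[of S] S by simp
    ultimately have "\<forall>\<^sub>F \<delta> in at_right 0. excess v S x - \<delta> * sum d S < excess v T x"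
      by (auto dest: order_tendstoD)
    then show ?thesis using S by (simp add: excess_def sum_y algebra_simps)
  qed
  then have "\<forall>\<^sub>F \<delta> in at_right 0. \<forall>S\<in>Pow (players n). excess v S (y \<delta>) < excess v T x"
    by (intro eventually_ball_finite) auto
  moreover have "\<forall>\<^sub>F \<delta> in at_right 0. sum x (players n) + \<delta> * sum d (players n) \<le> 1"
  proof (cases "sum d (players n) \<le> 0")
    case True
    have "\<forall>\<^sub>F \<delta> in at_right (0::real). \<delta> > 0" by (rule eventually_at_right_less)
    then show ?thesis
    proof eventually_elim
      case (elim \<delta>)
      then have "\<delta> * sum d (players n) \<le> 0" using True by (simp add: mult_le_0_iff)
      then show ?case using alloc by (simp add: allocation_def)
    qed
  next
    case False
    have "((\<lambda>\<delta>. sum x (players n) + \<delta> * sum d (players n)) \<longlongrightarrow>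
        sum x (players n) + 0 * sum d (players n)) (at_right 0)"
      by (intro tendsto_intros)
    then have "\<forall>\<^sub>F \<delta> in at_right 0. sum x (players n) + \<delta> * sum d (players n) < 1"
      using d False by (auto dest: order_tendstoD)
    then show ?thesis by eventually_elim simp
  qed
  ultimately have "\<forall>\<^sub>F \<delta> in at_right 0. (\<forall>S\<in>Pow (players n). excess v S (y \<delta>) < excess v T x) \<and>
      sum x (players n) + \<delta> * sum d (players n) \<le> 1"
    by eventually_elim simp
  then obtain \<delta> where less: "\<And>S. S \<subseteq> players n \<Longrightarrow> excess v S (y \<delta>) < excess v T x"
    and "sum x (players n) + \<delta> * sum d (players n) \<le> 1"
    by (auto dest!: eventually_happens)
  then have "allocation n (y \<delta>)"
    using alloc sum_y[of "players n"] by (simp add: allocation_def y_def)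
  then show False using nucleolus_max_excess[OF x _ T] less by (meson not_le)
qed

text \<open>The swap permutes the coalitions and preserves their values, so it only reorders the
  multiset of excesses.\<close>

lemma excess_vector_transpose:
  assumes inv: "\<And>S. S \<subseteq> players n \<Longrightarrow> v (Transposition.transpose i k ` S) \<longleftrightarrow> v S"
    and ik: "i \<in> players n" "k \<in> players n"
  shows "excess_vector n v (x \<circ> Transposition.transpose i k) = excess_vector n v x"
proof -
  let ?\<tau> = "Transposition.transpose i k"
  have exc: "excess v S (x \<circ> ?\<tau>) = excess v (?\<tau> ` S) x" if "S \<in> Pow (players n)" for S
    using that inv by (simp add: excess_def sum.reindex)
  have img: "?\<tau> ` S \<subseteq> players n" if "S \<subseteq> players n" for S
    using that ik by (auto simp: Transposition.transpose_def)
  have inv2: "?\<tau> ` ?\<tau> ` S = S" for S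
    by (simp add: image_image)
  have bij: "bij_betw ((`) ?\<tau>) (Pow (players n)) (Pow (players n))"
    by (rule bij_betwI[where g = "(`) ?\<tau>"]) (use img inv2 in auto)
  have "image_mset (\<lambda>S. excess v S (x \<circ> ?\<tau>)) (mset_set (Pow (players n))) =
      image_mset (\<lambda>S. excess v (?\<tau> ` S) x) (mset_set (Pow (players n)))"
    using exc by (intro image_mset_cong) auto
  also have "\<dots> = image_mset (\<lambda>S. excess v S x) (image_mset ((`) ?\<tau>) (mset_set (Pow (players n))))"
    by (simp add: multiset.map_comp comp_def)
  also have "image_mset ((`) ?\<tau>) (mset_set (Pow (players n))) = mset_set (Pow (players n))"
    using image_mset_mset_set[OF bij_betw_imp_inj_on[OF bij]] bij_betw_imp_surj_on[OF bij] by simp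
  finally show ?thesis by (simp only: excess_vector_def)
qed

text \<open>Swapping two symmetric players turns the nucleolus into a nucleolus again, and
  uniqueness identifies the two.\<close>

lemma nucleolus_transpose_invariant:
  assumes x: "is_nucleolus n v x" and inv: "\<And>S. S \<subseteq> players n \<Longrightarrow> v (Transposition.transpose i k ` S) \<longleftrightarrow> v S"
    and ik: "i \<in> players n" "k \<in> players n"
  shows "x i = x k"
proof -
  let ?\<tau> = "Transposition.transpose i k"
  have "sum (x \<circ> ?\<tau>) (players n) = sum x (players n)"
    using ik by (intro sum.reindex_bij_betw[of ?\<tau>, unfolded comp_def[symmetric]] bij_betwI[where g = ?\<tau>])
      (auto simp: Transposition.transpose_def)
  moreover have "?\<tau> j \<notin> players n" if "j \<notin> players n" for j
    using that ik by (auto simp: Transposition.transpose_def)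
  ultimately have "is_nucleolus n v (x \<circ> ?\<tau>)"
    using x excess_vector_transpose[OF inv ik, of x] by (auto simp: is_nucleolus_def allocation_def)
  then have "x \<circ> ?\<tau> = x" using is_nucleolus_unique x by blast
  from fun_cong[OF this, of i] show ?thesis by simp
qed

end

theorem Nuc_bound:
  assumes v: "simple_game n v" and i: "i \<in> players n"
  shows "Nuc n v i = 1 \<or> Nuc n v i \<le> 1/2"
proof (rule disjCI)
  let ?N = "players n"
  define x where "x = Nuc n v"
  have x: "is_nucleolus n v x" unfolding x_def by (rule is_nucleolus_Nuc)
  have sum_le: "sum x ?N \<le> 1" using x by (simp add: is_nucleolus_def allocation_def)
  have fin: "finite S" if "S \<subseteq> ?N" for S
    using that finite_subset[OF _ finite_players] by blast
  define E where "E = Max ((\<lambda>S. excess v S x) ` Pow ?N)"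
  have "E \<in> (\<lambda>S. excess v S x) ` Pow ?N" unfolding E_def by (rule Max_in) auto
  then obtain T where T: "T \<subseteq> ?N" and ET: "E = excess v T x" by auto
  have maxE: "excess v S x \<le> E" if "S \<subseteq> ?N" for S
    unfolding E_def using that by (intro Max_ge) auto
  have empty: "excess v {} x = 0" using simple_game_empty[OF v] by (simp add: excess_def)
  have direction: "\<exists>S\<subseteq>?N. excess v S x = E \<and> sum d S \<le> 0"
    if "sum d ?N \<le> 0 \<or> sum x ?N < 1" for d :: "nat \<Rightarrow> real"
    using nucleolus_direction[OF x T maxE[unfolded ET] that] by (simp add: ET)
  show "Nuc n v i = 1" if big: "\<not> Nuc n v i \<le> 1/2"
  proof -
    have xi: "x i > 1/2" using big by (simp add: x_def)
    have "E \<le> 0"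
    proof (rule ccontr)
      assume "\<not> E \<le> 0"
      then have E: "E > 0" by simp
      have ne: "S \<noteq> {}" if "excess v S x = E" for S
        using that E empty by auto
      have sum1: "sum x ?N = 1"
      proof (rule ccontr)
        assume "sum x ?N \<noteq> 1"
        \<comment> \<open>With slack in the total, everyone could receive more; this fails only for
          an empty maximal coalition, whose excess is 0 and not \<open>E\<close>.\<close>
        then obtain S where "S \<subseteq> ?N" "excess v S x = E" "sum (\<lambda>_. 1::real) S \<le> 0"
          using direction[of "\<lambda>_. 1"] sum_le by auto
        then show False using ne fin by auto
      qed
      have exN: "excess v ?N x = 0"
        using sum1 simple_game_players[OF v] by (simp add: excess_def)
      have nonneg: "x j \<ge> 0" if j: "j \<in> ?N" for j
      proof (rule ccontr)
        assume neg: "\<not> x j \<ge> 0"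
        \<comment> \<open>Every other player pays one unit to \<open>j\<close>. The total change is
          0, but every proper coalition containing \<open>j\<close> gains. A negative
          \<open>x j\<close> puts \<open>j\<close> into each maximal coalition, and the grand
          coalition is not maximal because its excess is 0.\<close>
        let ?d = "\<lambda>k. if k = j then real n - 1 else -1"
        have sum_d: "sum ?d S = real n - card S" if "S \<subseteq> ?N" "j \<in> S" for S
        proof -
          have "sum ?d S = (\<Sum>k\<in>S. (if k = j then real n else 0) - 1)"
            by (rule sum.cong) auto
          then show ?thesis using that fin by (simp add: sum_subtractf)
        qed
        have "sum ?d ?N \<le> 0" using sum_d[OF order_refl j] by simp
        then obtain S where S: "S \<subseteq> ?N" "excess v S x = E" "sum ?d S \<le> 0"
          using direction[of ?d] by blast
        have "j \<in> S"
        proof (rule ccontr)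
          assume "j \<notin> S"
          have "v S \<Longrightarrow> v (insert j S)"
            using simple_game_mono[OF v, of S "insert j S"] S(1) j by auto
          then have "excess v S x < excess v (insert j S) x"
            using \<open>j \<notin> S\<close> fin[OF S(1)] neg by (auto simp: excess_def)
          then show False using maxE[of "insert j S"] S j by simp
        qed
        moreover have "S \<noteq> ?N" using S(2) exN E by auto
        then have "card S < n" using S(1) psubset_card_mono[of ?N S] by auto
        ultimately show False using sum_d[OF S(1)] S(3) by simp
      qed
      have le_i: "sum x S \<le> 1 - x i" if "S \<subseteq> ?N" "i \<notin> S" for S
        using that i nonneg sum1 by (intro sum_le_complement[of ?N]) auto
      have ge_i: "x i \<le> sum x S" if "S \<subseteq> ?N" "i \<in> S" for S
        using that nonneg fin by (intro member_le_sum) auto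
      show False
      proof (cases "\<exists>S\<subseteq>?N. v S \<and> i \<notin> S")
        case True
        then obtain S where S: "S \<subseteq> ?N" "v S" "i \<notin> S" by blast
        have E_half: "E > 1/2"
          using maxE[OF S(1)] le_i[OF S(1,3)] S(2) xi by (simp add: excess_def)
        \<comment> \<open>Some winning coalition avoids \<open>i\<close>, so \<open>E > 1/2\<close>,
          whereas coalitions containing \<open>i\<close> have excess at most
          \<open>1 - x i < 1/2\<close>. Hence maximal coalitions avoid \<open>i\<close>, and all of
          them gain when \<open>i\<close> pays one unit to each of the others.\<close>
        let ?d = "\<lambda>k. if k = i then - real n else 1"
        have "sum ?d ?N = - real n + sum (\<lambda>_. 1) (?N - {i})"
          by (subst sum.remove[OF finite_players i]) (auto intro!: sum.cong)
        also have "\<dots> \<le> 0" using i by simp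
        finally obtain R where R: "R \<subseteq> ?N" "excess v R x = E" "sum ?d R \<le> 0"
          using direction[of ?d] by blast
        have "i \<notin> R"
        proof
          assume "i \<in> R"
          then have "excess v R x \<le> 1 - x i" using ge_i[OF R(1)] by (auto simp: excess_def)
          then show False using R(2) E_half xi by simp
        qed
        then have "sum ?d R = sum (\<lambda>_. 1) R" by (intro sum.cong) auto
        then show False using R ne[OF R(2)] fin[OF R(1)] by simp
      next
        case False
        \<comment> \<open>Here every winning coalition contains \<open>i\<close>, so giving
          everything to \<open>i\<close> leaves no positive excess.\<close>
        let ?y = "\<lambda>j. if j = i then 1 else 0 :: real"
        have "allocation n ?y" using i by (auto simp: allocation_def)
        then obtain S where S: "S \<subseteq> ?N" "E \<le> excess v S ?y"
          using nucleolus_max_excess[OF x _ T] by (auto simp: ET)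
        moreover have "excess v S ?y \<le> 0"
          using False S(1) fin[OF S(1)] by (auto simp: excess_def)
        ultimately show False using E by simp
      qed
    qed
    then have ge: "of_bool (v S) \<le> sum x S" if "S \<subseteq> ?N" for S
      using maxE[OF that] by (simp add: excess_def)
    have sum1: "sum x ?N = 1"
      using sum_le ge[of ?N] simple_game_players[OF v] by simp
    have nonneg: "x j \<ge> 0" if "j \<in> ?N" for j
      using ge[of "{j}"] that by (cases "v {j}") auto
    have complement: "x j + sum x S \<le> 1" if "S \<subseteq> ?N" "j \<in> ?N" "j \<notin> S" for j S
      using sum_le_complement[of ?N x S j] that nonneg sum1 by simp
    have veto: "i \<in> S" if "S \<subseteq> ?N" "v S" for S
      using complement[OF that(1) i] ge[OF that(1)] that(2) xi by fastforce
    \<comment> \<open>If \<open>k\<close> lies in every winning coalition, it is symmetric to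
      \<open>i\<close>, and two shares above \<open>1/2\<close> exceed the total. Otherwise a
      winning coalition without \<open>k\<close> already takes the whole unit.\<close>
    have "x k = 0" if k: "k \<in> ?N - {i}" for k
    proof (cases "\<forall>S\<subseteq>?N. v S \<longrightarrow> k \<in> S")
      case True
      have "v (Transposition.transpose i k ` S) \<longleftrightarrow> v S" if S: "S \<subseteq> ?N" for S
      proof -
        let ?\<tau> = "Transposition.transpose i k"
        have img: "?\<tau> ` R = R" if "R \<subseteq> ?N" "v R" for R
        proof -
          have "i \<in> R" "k \<in> R" using veto True that by auto
          then show ?thesis by (simp add: transpose_image_eq)
        qed
        have "?\<tau> ` S \<subseteq> ?N" using S i k by (auto simp: Transposition.transpose_def)
        moreover have "?\<tau> ` ?\<tau> ` S = S" by (simp add: image_image)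
        ultimately show ?thesis using img[of S] img[of "?\<tau> ` S"] S by metis
      qed
      then have "x i = x k" using nucleolus_transpose_invariant[OF x] i k by blast
      then show ?thesis using complement[of "{i}" k] i k xi by simp
    next
      case False
      then obtain S where "S \<subseteq> ?N" "v S" "k \<notin> S" by blast
      then show ?thesis using complement[of S k] ge[of S] nonneg[of k] k by simp
    qed
    then have "x i = 1" using sum1 sum.remove[OF finite_players i, of x] by simp
    then show ?thesis by (simp add: x_def)
  qed
qed

section \<open>Averages over polytopes\<close>

definition unit_vec :: "nat \<Rightarrow> nat \<Rightarrow> real" where
  "unit_vec p j = (if j = p then 1 else 0)"

text \<open>The form of the affine hulls of both polytopes. The coefficients \<open>c\<close> allow
  the quota coordinate to be left out of the normalisation.\<close>

definition hyperplane :: "nat set \<Rightarrow> (nat \<Rightarrow> real) \<Rightarrow> (nat \<Rightarrow> real) set" where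
  "hyperplane I c = {z. (\<forall>j. j \<notin> I \<longrightarrow> z j = 0) \<and> (\<Sum>j\<in>I. c j * z j) = 1}"

text \<open>The point \<open>z0\<close> is relatively interior: with
  \<open>q = z0 + \<delta> * (y - z0)\<close> in \<open>P\<close>, any \<open>y\<close> of the
  hyperplane is the affine combination
  \<open>(1 - 1/\<delta>) * z0 + (1/\<delta>) * q\<close>.\<close>

lemma aff_hull_eq_hyperplane:
  assumes sub: "P \<subseteq> hyperplane I c" and z0: "z0 \<in> P"
    and interior: "\<And>y. y \<in> hyperplane I c \<Longrightarrow> \<exists>\<delta>>0. (\<lambda>j. z0 j + \<delta> * (y j - z0 j)) \<in> P"
  shows "aff_hull P = hyperplane I c"
proof (intro equalityI subsetI)
  fix y assume "y \<in> aff_hull P"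
  then obtain F u where F: "finite F" "F \<subseteq> P" "(\<Sum>p\<in>F. u p) = 1"
    and y: "y = (\<lambda>j. \<Sum>p\<in>F. u p * p j)"
    by (auto simp: aff_hull_def)
  have FH: "F \<subseteq> hyperplane I c" using F sub by blast
  have "(\<Sum>j\<in>I. c j * y j) = (\<Sum>j\<in>I. \<Sum>p\<in>F. u p * (c j * p j))"
    by (simp add: y sum_distrib_left mult_ac)
  also have "\<dots> = (\<Sum>p\<in>F. u p * (\<Sum>j\<in>I. c j * p j))"
    by (subst sum.swap) (simp add: sum_distrib_left)
  also have "\<dots> = (\<Sum>p\<in>F. u p * 1)"
    using FH by (intro sum.cong) (auto simp: hyperplane_def)
  finally have "(\<Sum>j\<in>I. c j * y j) = 1" using F by simp
  moreover have "y j = 0" if "j \<notin> I" for j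
    unfolding y using FH that by (intro sum.neutral) (auto simp: hyperplane_def)
  ultimately show "y \<in> hyperplane I c" by (simp add: hyperplane_def)
next
  fix y assume "y \<in> hyperplane I c"
  then obtain \<delta> where \<delta>: "\<delta> > 0" "(\<lambda>j. z0 j + \<delta> * (y j - z0 j)) \<in> P" (is "?q \<in> P")
    using interior by blast
  have "\<exists>F u. finite F \<and> F \<subseteq> P \<and> F \<noteq> {} \<and> (\<Sum>p\<in>F. u p) = 1 \<and> y = (\<lambda>j. \<Sum>p\<in>F. u p * p j)"
  \<comment> \<open>The combination is indexed by a set of points, so coinciding points need a
    one-element family.\<close>
  proof (cases "?q = z0")
    case True
    have "y j = z0 j" for j
      using fun_cong[OF True, of j] \<delta> by simp
    then show ?thesis
      using z0 by (intro exI[of _ "{z0}"] exI[of _ "\<lambda>_. 1"]) auto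
  next
    case False
    let ?u = "\<lambda>p. if p = z0 then 1 - 1/\<delta> else 1/\<delta>"
    have "y = (\<lambda>j. (1 - 1/\<delta>) * z0 j + 1/\<delta> * ?q j)"
      using \<delta>(1) by (auto simp: field_simps)
    then show ?thesis
      using z0 \<delta> False by (intro exI[of _ "{z0, ?q}"] exI[of _ ?u]) auto
  qed
  then show "y \<in> aff_hull P" by (simp add: aff_hull_def)
qed

section \<open>Affine parametrisations and dilations of Lebesgue measure\<close>

lemma space_lebesgue_k: "space (lebesgue_k k) = (\<Pi>\<^sub>E l\<in>{..<k}. UNIV)"
  by (simp add: lebesgue_k_def space_PiM)

text \<open>The equation is solved for coordinate \<open>p\<close>, whose coefficient is 1; the
  remaining coordinates, enumerated by \<open>h\<close>, are free parameters. This makes the choice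
  in \<open>poly_avg\<close> meaningful.\<close>

lemma hyperplane_affine_param:
  assumes I: "finite I" "p \<in> I" "c p = 1" and hull: "aff_hull P = hyperplane I c"
  shows "\<exists>g. affine_param P (card I - 1) g"
proof -
  define k where "k = card I - 1"
  have "card (I - {p}) = k" using I by (simp add: k_def)
  then obtain h where h: "bij_betw h {..<k} (I - {p})"
    using ex_bij_betw_nat_finite[of "I - {p}"] I by (auto simp: atLeast0LessThan)
  have hI: "h l \<in> I" "h l \<noteq> p" if "l < k" for l
    using bij_betwE[OF h] that by auto
  have h_inj: "h l = h l' \<longleftrightarrow> l = l'" if "l < k" "l' < k" for l l'
    using bij_betw_imp_inj_on[OF h] that by (auto simp: inj_on_def)
  define b where "b l j = (if j = h l then 1 else if j = p then - c (h l) else 0)" for l j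
  define g where "g t j = unit_vec p j + (\<Sum>l<k. t l * b l j)" for t :: "nat \<Rightarrow> real" and j
  have g_h: "g t (h l) = t l" if "l < k" for t l
  proof -
    have "(\<Sum>l'<k. t l' * b l' (h l)) = (\<Sum>l'<k. if l' = l then t l' else 0)"
      using that hI h_inj by (intro sum.cong) (auto simp: b_def)
    then show ?thesis using that hI by (simp add: g_def unit_vec_def)
  qed
  have g_p: "g t p = 1 - (\<Sum>l<k. c (h l) * t l)" for t
  proof -
    have "(\<Sum>l<k. t l * b l p) = (\<Sum>l<k. - (c (h l) * t l))"
      using hI by (intro sum.cong) (auto simp: b_def)
    then show ?thesis by (simp add: g_def unit_vec_def sum_negf)
  qed
  have g_out: "g t j = 0" if "j \<notin> I" for t j
  proof -
    have "(\<Sum>l<k. t l * b l j) = 0"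
      using that hI I by (intro sum.neutral) (auto simp: b_def)
    then show ?thesis using that I by (auto simp: g_def unit_vec_def)
  qed
  have sum_I: "(\<Sum>j\<in>I. f j) = f p + (\<Sum>l<k. f (h l))" for f :: "nat \<Rightarrow> real"
    using sum.remove[OF I(1,2), of f] sum.reindex_bij_betw[OF h, of f] by simp
  have "inj_on g (space (lebesgue_k k))"
  proof (rule inj_onI)
    fix s t assume st: "s \<in> space (lebesgue_k k)" "t \<in> space (lebesgue_k k)" and "g s = g t"
    then have "s l = t l" if "l < k" for l
      using g_h[OF that] by metis
    then show "s = t" using st by (auto simp: space_lebesgue_k intro: PiE_ext)
  qed
  moreover have "g ` space (lebesgue_k k) = hyperplane I c"
  proof (intro equalityI subsetI)
    fix z assume "z \<in> g ` space (lebesgue_k k)"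
    then show "z \<in> hyperplane I c"
      using I by (auto simp: hyperplane_def sum_I g_h g_p g_out)
  next
    fix z assume z: "z \<in> hyperplane I c"
    define t where "t = restrict (\<lambda>l. z (h l)) {..<k}"
    have "g t j = z j" for j
    proof -
      consider "j \<notin> I" | "j = p" | "j \<in> I - {p}" by blast
      then show ?thesis
      proof cases
        case 1
        then show ?thesis using z g_out by (simp add: hyperplane_def)
      next
        case 2
        have "z p = 1 - (\<Sum>l<k. c (h l) * t l)"
          using z I by (simp add: hyperplane_def sum_I t_def)
        then show ?thesis using 2 g_p by simp
      next
        case 3
        then obtain l where "l < k" "j = h l" using h by (auto simp: bij_betw_def)
        then show ?thesis using g_h by (simp add: t_def)
      qed
    qed
    then have "z = g t" by auto
    moreover have "t \<in> space (lebesgue_k k)" by (auto simp: t_def space_lebesgue_k)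
    ultimately show "z \<in> g ` space (lebesgue_k k)" by blast
  qed
  ultimately have "affine_param P k g"
    unfolding affine_param_def hull by (auto simp: g_def fun_eq_iff)
  then show ?thesis unfolding k_def by blast
qed

lemma sum_fun_apply: "(\<Sum>a\<in>A. f a) x = (\<Sum>a\<in>A. f a x)"
  for f :: "'a \<Rightarrow> 'b \<Rightarrow> real"
  by (induction A rule: infinite_finite_induct) auto

interpretation real_fun: vector_space "\<lambda>(c::real) (f::nat \<Rightarrow> real) x. c * f x"
  by standard (auto simp: fun_eq_iff algebra_simps)

text \<open>Since \<open>poly_avg\<close> picks an arbitrary parametrisation, its dimension must be
  bounded for every candidate. The vectors \<open>unit_vec j - c j * unit_vec p\<close> with
  \<open>j \<noteq> p\<close> are differences of hyperplane points, hence lie in the span of the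
  \<open>k\<close> vectors \<open>b l\<close>, and they are independent.\<close>

lemma hyperplane_affine_param_dim:
  assumes I: "finite I" "p \<in> I" "c p = 1" and hull: "aff_hull P = hyperplane I c"
    and param: "affine_param P k g"
  shows "card I - 1 \<le> k"
proof -
  obtain a b where g: "g = (\<lambda>t j. a j + (\<Sum>l<k. t l * b l j))"
    and img: "g ` space (lebesgue_k k) = hyperplane I c"
    using param hull by (auto simp: affine_param_def)
  define d where "d j = (\<lambda>x. unit_vec j x - c j * unit_vec p x)" for j
  \<comment> \<open>Away from \<open>p\<close> these are standard unit vectors, so evaluating at
    \<open>j\<close> isolates the coefficient of \<open>d j\<close>.\<close>
  have d_self: "d j j' = (if j = j' then 1 else 0)" if "j' \<noteq> p" for j j'
    using that by (auto simp: d_def unit_vec_def)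
  have inj: "inj_on d (I - {p})"
    by (rule inj_onI) (metis DiffD2 d_self singletonI zero_neq_one)
  have diff_span: "(\<lambda>x. y x - z x) \<in> real_fun.span (b ` {..<k})"
    if yz: "y \<in> hyperplane I c" "z \<in> hyperplane I c" for y z
  proof -
    obtain s t where st: "y = g s" "z = g t" using yz img by (metis image_iff)
    have "(\<lambda>x. y x - z x) = (\<Sum>l<k. (\<lambda>x. (s l - t l) * b l x))"
      by (simp add: st g fun_eq_iff sum_fun_apply sum_subtractf algebra_simps)
    also have "\<dots> \<in> real_fun.span (b ` {..<k})"
      by (intro real_fun.span_sum real_fun.span_scale real_fun.span_base) auto
    finally show ?thesis .
  qed
  have p_in: "unit_vec p \<in> hyperplane I c"
    using I by (auto simp: hyperplane_def unit_vec_def if_distrib[of "\<lambda>x. _ * x"] cong: if_cong)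
  have "d ` (I - {p}) \<subseteq> real_fun.span (b ` {..<k})"
  proof (rule image_subsetI)
    fix j assume "j \<in> I - {p}"
    then have j: "j \<in> I" "j \<noteq> p" by auto
    let ?y = "\<lambda>x. unit_vec p x + d j x"
    have "(\<Sum>x\<in>I. c x * ?y x) = (\<Sum>x\<in>I. if x = j then c j else 0) + (\<Sum>x\<in>I. if x = p then 1 - c j else 0)"
      unfolding sum.distrib[symmetric] using I j by (intro sum.cong) (auto simp: d_def unit_vec_def)
    then have "?y \<in> hyperplane I c"
      using I j by (auto simp: hyperplane_def d_def unit_vec_def)
    from diff_span[OF this p_in] show "d j \<in> real_fun.span (b ` {..<k})" by simp
  qed
  moreover have "real_fun.independent (d ` (I - {p}))"
  proof (rule real_fun.independent_if_scalars_zero)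
    fix f y assume sum0: "(\<Sum>y\<in>d ` (I - {p}). (\<lambda>x. f y * y x)) = 0" and "y \<in> d ` (I - {p})"
    then obtain j where j: "j \<in> I - {p}" "y = d j" by blast
    have "(0::real) = (\<Sum>y\<in>d ` (I - {p}). f y * y j)"
      using fun_cong[OF sum0, of j] by (simp add: sum_fun_apply)
    also have "\<dots> = (\<Sum>i\<in>I - {p}. if i = j then f (d i) else 0)"
      using j by (subst sum.reindex[OF inj], intro sum.cong) (auto simp: d_self)
    also have "\<dots> = f (d j)" using j I by simp
    finally show "f y = 0" using j by simp
  qed (use I in auto)
  ultimately have "card (d ` (I - {p})) \<le> card (b ` {..<k})"
    using real_fun.independent_span_bound by blast
  also have "\<dots> \<le> k" using card_image_le[of "{..<k}" b] by simp
  finally show ?thesis using I inj by (simp add: card_image)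
qed

lemma emeasure_lborel_affine_vimage:
  fixes r t :: real
  assumes "r > 0" and B: "B \<in> sets borel"
  shows "emeasure lborel B = ennreal r * emeasure lborel ((\<lambda>x. t + r * x) -` B)"
proof -
  have "emeasure lborel B = emeasure (density (distr lborel borel (\<lambda>x. t + r * x)) (\<lambda>_. ennreal \<bar>r\<bar>)) B"
    using lborel_real_affine[of r t] assms by simp
  also have "\<dots> = ennreal r * emeasure (distr lborel borel (\<lambda>x. t + r * x)) B"
    using assms by (subst emeasure_density_const) auto
  also have "\<dots> = ennreal r * emeasure lborel ((\<lambda>x. t + r * x) -` B)"
    using assms by (subst emeasure_distr) auto
  finally show ?thesis .
qed

text \<open>Dilation with centre \<open>c\<close> and factor \<open>r\<close> scales volume by
  \<open>r ^ k\<close>. A product measure is determined by its values on boxes, where the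
  one-dimensional change of variables applies in each coordinate.\<close>

lemma
  fixes c :: "nat \<Rightarrow> real" and r :: real and k :: nat
  assumes r: "r > 0"
  defines "h \<equiv> \<lambda>t. \<lambda>l\<in>{..<k}. c l + r * (t l - c l)"
  shows measurable_dilation: "h \<in> measurable (lebesgue_k k) (lebesgue_k k)"
    and emeasure_dilation: "A \<in> sets (lebesgue_k k) \<Longrightarrow>
      emeasure (lebesgue_k k) A = ennreal (r ^ k) * emeasure (lebesgue_k k) (h -` A \<inter> space (lebesgue_k k))"
proof -
  interpret product_sigma_finite "\<lambda>_::nat. lborel :: real measure" by standard
  show h[measurable]: "h \<in> measurable (lebesgue_k k) (lebesgue_k k)"
    unfolding h_def lebesgue_k_def by measurable
  let ?D = "scale_measure (ennreal (r ^ k)) (distr (lebesgue_k k) (lebesgue_k k) h)"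
  have "?D = PiM {..<k} (\<lambda>_. lborel)"
  proof (rule PiM_eqI)
    fix B :: "nat \<Rightarrow> real set"
    assume B: "\<And>i. i \<in> {..<k} \<Longrightarrow> B i \<in> sets lborel"
    let ?B' = "\<lambda>l. (\<lambda>x. (c l - r * c l) + r * x) -` B l"
    have box: "Pi\<^sub>E {..<k} B \<in> sets (lebesgue_k k)"
      unfolding lebesgue_k_def using B by (intro sets_PiM_I_finite) auto
    have B': "?B' l \<in> sets lborel" if "l \<in> {..<k}" for l
    proof -
      have "(\<lambda>x. (c l - r * c l) + r * x) -` B l \<inter> space borel \<in> sets borel"
        using B[OF that] by (intro measurable_sets[of _ borel borel]) auto
      then show ?thesis by simp
    qed
    have "h -` Pi\<^sub>E {..<k} B \<inter> space (lebesgue_k k) = Pi\<^sub>E {..<k} ?B'"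
      by (auto simp: space_lebesgue_k h_def PiE_iff algebra_simps extensional_def)
    then have "emeasure ?D (Pi\<^sub>E {..<k} B) = ennreal (r ^ k) * emeasure (lebesgue_k k) (Pi\<^sub>E {..<k} ?B')"
      using box by (simp add: emeasure_distr)
    also have "\<dots> = ennreal (r ^ k) * (\<Prod>l<k. emeasure lborel (?B' l))"
      unfolding lebesgue_k_def using B' by (subst emeasure_PiM) auto
    also have "\<dots> = (\<Prod>l<k. ennreal r * emeasure lborel (?B' l))"
      using r by (simp add: prod.distrib ennreal_power)
    also have "\<dots> = (\<Prod>l<k. emeasure lborel (B l))"
      using B by (intro prod.cong refl emeasure_lborel_affine_vimage[symmetric] r) auto
    finally show "emeasure ?D (Pi\<^sub>E {..<k} B) = (\<Prod>l<k. emeasure lborel (B l))" .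
  qed (simp_all add: lebesgue_k_def)
  then have D: "lebesgue_k k = ?D" by (simp add: lebesgue_k_def)
  show "emeasure (lebesgue_k k) A = ennreal (r ^ k) * emeasure (lebesgue_k k) (h -` A \<inter> space (lebesgue_k k))"
    if "A \<in> sets (lebesgue_k k)"
    using that by (subst D) (simp add: emeasure_distr)
qed

text \<open>The points of \<^term>\<open>P\<close> with \<^term>\<open>z i > 1/2 + \<epsilon>\<close> lie in the images of \<^term>\<open>P\<close> under
  the contractions by the factor \<^term>\<open>1 - \<epsilon>\<close> towards the points of \<^term>\<open>C\<close>; each image has
  relative volume \<^term>\<open>(1 - \<epsilon>) ^ k\<close>.\<close>

lemma poly_avg_coordinate_le:
  fixes \<epsilon> :: real
  assumes param: "\<exists>k g. affine_param P k g"
    and dim: "\<And>k g. affine_param P k g \<Longrightarrow> m \<le> k"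
    and unit: "\<And>z. z \<in> P \<Longrightarrow> 0 \<le> z i \<and> z i \<le> 1"
    and \<epsilon>: "0 < \<epsilon>" "\<epsilon> < 1"
    and C: "finite C" "C \<subseteq> aff_hull P"
    and dilate: "\<And>z. z \<in> P \<Longrightarrow> z i > 1/2 + \<epsilon> \<Longrightarrow>
      \<exists>c\<in>C. (\<lambda>j. c j + 1 / (1 - \<epsilon>) * (z j - c j)) \<in> P"
  shows "poly_avg P (\<lambda>z. z i) \<le> 1/2 + \<epsilon> + card C * (1 - \<epsilon>) ^ m"
proof -
  define kg where "kg = (SOME kg. affine_param P (fst kg) (snd kg))"
  define k g where "k = fst kg" and "g = snd kg"
  have "\<exists>kg. affine_param P (fst kg) (snd kg)" using param by auto
  then have kg: "affine_param P k g" unfolding kg_def k_def g_def by (rule someI_ex)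
  obtain a b where g: "g = (\<lambda>t j. a j + (\<Sum>l<k. t l * b l j))"
    and img: "g ` space (lebesgue_k k) = aff_hull P"
    using kg by (auto simp: affine_param_def)
  let ?M = "lebesgue_k k"
  define A where "A = g -` P \<inter> space ?M"
  have avg: "poly_avg P (\<lambda>z. z i) = (\<integral>t. indicator A t * g t i \<partial>?M) / measure ?M A"
    unfolding poly_avg_def kg_def[symmetric]
    by (simp add: Let_def A_def k_def g_def split: prod.split)
  define r where "r = 1 / (1 - \<epsilon>)"
  have r: "r > 0" "1 / r = 1 - \<epsilon>" using \<epsilon> by (auto simp: r_def)
  have pos: "1/2 + \<epsilon> + card C * (1 - \<epsilon>) ^ m \<ge> 0" using \<epsilon> by simp
  show ?thesis
  proof (cases "measure ?M A = 0")
    case True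
    then show ?thesis using avg pos by simp
  next
    case False
    \<comment> \<open>The value of \<open>measure\<close> defaults to 0 on non-measurable sets and
      on sets of infinite volume, so a nonzero value excludes both.\<close>
    then have A: "A \<in> sets ?M" "emeasure ?M A \<noteq> \<infinity>"
      using measure_notin_sets[of A ?M] by (auto simp: measure_def)
    have mA: "measure ?M A > 0" using False by (simp add: zero_less_measure_iff)
    have "\<forall>c\<in>C. \<exists>t\<in>space ?M. g t = c" using C img by (metis imageE subsetD)
    then obtain \<tau> where \<tau>: "\<And>c. c \<in> C \<Longrightarrow> \<tau> c \<in> space ?M \<and> g (\<tau> c) = c" by metis
    \<comment> \<open>Dilation about the parameter of \<open>c\<close>; as \<open>g\<close> is
      affine, it corresponds to dilation about \<open>c\<close> itself.\<close>
    define h where "h c t = (\<lambda>l\<in>{..<k}. \<tau> c l + r * (t l - \<tau> c l))" for c t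
    define D where "D c = h c -` A \<inter> space ?M" for c
    have g_h: "g (h c t) = (\<lambda>j. c j + r * (g t j - c j))" if "c \<in> C" for c t
    proof
      fix j
      have "c j = a j + (\<Sum>l<k. \<tau> c l * b l j)"
        using \<tau>[OF that] by (metis g)
      then show "g (h c t) j = c j + r * (g t j - c j)"
        by (simp add: g h_def algebra_simps sum.distrib sum_subtractf sum_distrib_left)
    qed
    have D: "D c \<in> sets ?M" for c
      unfolding D_def h_def by (rule measurable_sets[OF measurable_dilation A(1)]) fact
    have eD: "emeasure ?M A = ennreal (r ^ k) * emeasure ?M (D c)" for c
      unfolding D_def h_def by (rule emeasure_dilation) (use r A in auto)
    have mD: "measure ?M (D c) = (1 - \<epsilon>) ^ k * measure ?M A" for c
    proof -
      have "measure ?M A = r ^ k * measure ?M (D c)"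
        using r by (simp add: measure_def eD[of c] enn2real_mult)
      then show ?thesis using r by (simp add: r(2)[symmetric] power_divide)
    qed
    have fD: "emeasure ?M (D c) < \<infinity>" for c
      using eD[of c] A(2) r by (auto simp: ennreal_mult_eq_top_iff less_top)
    \<comment> \<open>Majorant of the integrand: where the coordinate exceeds
      \<open>1/2 + \<epsilon>\<close> it is still at most 1, and \<open>t\<close> lies in some
      \<open>D c\<close>.\<close>
    define u where "u t = (1/2 + \<epsilon>) * indicator A t + (\<Sum>c\<in>C. indicator (D c) t)" for t :: "nat \<Rightarrow> real"
    have int: "integrable ?M (indicator A :: _ \<Rightarrow> real)" "integrable ?M (indicator (D c) :: _ \<Rightarrow> real)" for c
      using A D fD by (auto simp: less_top)
    have "(\<integral>t. indicator A t * g t i \<partial>?M) \<le> (\<integral>t. u t \<partial>?M)"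
    proof (rule integral_mono')
      show "integrable ?M u" unfolding u_def using int by auto
      fix t assume t: "t \<in> space ?M"
      have sn: "(\<Sum>c\<in>C. indicator (D c) t) \<ge> (0::real)" by (simp add: sum_nonneg)
      then show "0 \<le> u t" using \<epsilon> by (simp add: u_def)
      show "indicator A t * g t i \<le> u t"
      proof (cases "t \<in> A")
        case True
        then have gP: "g t \<in> P" by (simp add: A_def)
        show ?thesis
        proof (cases "g t i > 1/2 + \<epsilon>")
          case big: True
          obtain c where c: "c \<in> C" "g (h c t) \<in> P"
            using dilate[OF gP big] g_h by (auto simp: r_def)
          moreover have "h c t \<in> space ?M" by (auto simp: h_def space_lebesgue_k)
          ultimately have "t \<in> D c" using t by (simp add: D_def A_def)
          then have "1 = (indicator (D c) t :: real)" by simp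
          also have "\<dots> \<le> (\<Sum>c\<in>C. indicator (D c) t)"
            using c C by (intro member_le_sum) auto
          finally show ?thesis using unit[OF gP] True \<epsilon> by (simp add: u_def)
        next
          case False
          then show ?thesis using sn True by (simp add: u_def)
        qed
      next
        case False
        then show ?thesis using sn by (simp add: u_def)
      qed
    qed
    also have "(\<integral>t. u t \<partial>?M) = (1/2 + \<epsilon>) * measure ?M A + (\<Sum>c\<in>C. measure ?M (D c))"
      unfolding u_def using int A D by (simp add: Bochner_Integration.integral_sum)
    also have "\<dots> = (1/2 + \<epsilon> + card C * (1 - \<epsilon>) ^ k) * measure ?M A"
      by (simp add: mD algebra_simps)
    finally have "poly_avg P (\<lambda>z. z i) \<le> 1/2 + \<epsilon> + card C * (1 - \<epsilon>) ^ k"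
      using avg mA by (simp add: pos_divide_le_eq)
    moreover have "(1 - \<epsilon>) ^ k \<le> (1 - \<epsilon>) ^ m"
      using dim[OF kg] \<epsilon> by (intro power_decreasing) auto
    then have "card C * (1 - \<epsilon>) ^ k \<le> card C * (1 - \<epsilon>) ^ m"
      by (intro mult_left_mono) auto
    ultimately show ?thesis by linarith
  qed
qed

section \<open>Weight and representation polytopes\<close>

lemma eventually_Ball_perturb_pos:
  fixes \<alpha> \<beta> :: "'a \<Rightarrow> real"
  assumes "finite X" "\<And>x. x \<in> X \<Longrightarrow> \<alpha> x > 0"
  shows "\<forall>\<^sub>F \<delta> in at_right 0. \<forall>x\<in>X. \<alpha> x + \<delta> * \<beta> x > 0"
proof (rule eventually_ball_finite[OF assms(1)], rule ballI)
  fix x assume "x \<in> X"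
  have "((\<lambda>\<delta>. \<alpha> x + \<delta> * \<beta> x) \<longlongrightarrow> \<alpha> x + 0 * \<beta> x) (at_right 0)"
    by (intro tendsto_intros)
  then show "\<forall>\<^sub>F \<delta> in at_right 0. \<alpha> x + \<delta> * \<beta> x > 0"
    using assms(2)[OF \<open>x \<in> X\<close>] by (auto dest: order_tendstoD)
qed

text \<open>Such points lie in the relative interior of \<open>Pr n v\<close>, with the quota in
  coordinate 0.\<close>

definition strict_rep :: "nat \<Rightarrow> (nat set \<Rightarrow> bool) \<Rightarrow> (nat \<Rightarrow> real) \<Rightarrow> bool" where
  "strict_rep n v z \<longleftrightarrow> (\<forall>j>n. z j = 0) \<and> (\<forall>j\<le>n. z j > 0) \<and> z 0 < 1 \<and> sum z (players n) = 1 \<and>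
    (\<forall>S\<subseteq>players n. if v S then z 0 < sum z S else sum z S < z 0)"

text \<open>Two perturbations and a rescaling: lowering the quota by \<open>\<theta>\<close> makes
  the winning inequalities strict, adding \<open>\<eta>\<close> to each weight makes the weights
  positive, and both are small enough to keep losing coalitions strictly below the quota. Dividing
  by \<open>W\<close> normalises.\<close>

lemma weighted_game_strict_rep:
  assumes "weighted_game n v"
  shows "\<exists>z. strict_rep n v z"
proof -
  obtain q w where q: "q > (0::real)" and w: "\<And>j. j \<in> players n \<Longrightarrow> w j \<ge> 0"
    and rep: "\<And>S. S \<subseteq> players n \<Longrightarrow> v S \<longleftrightarrow> (\<Sum>j\<in>S. w j) \<ge> q"
    and v: "simple_game n v"
    using assms by (auto simp: weighted_game_def)
  let ?L = "{S \<in> Pow (players n). \<not> v S}"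
  have "\<forall>\<^sub>F \<theta> in at_right 0. (\<forall>S\<in>?L. (q - (\<Sum>j\<in>S. w j)) + \<theta> * (- 1) > 0) \<and>
          (\<forall>x\<in>{()}. q + \<theta> * (- 1) > 0) \<and> \<theta> > (0::real)"
    using rep q by (intro eventually_conj eventually_Ball_perturb_pos eventually_at_right_less)
      (auto simp: not_le)
  then obtain \<theta> :: real where \<theta>: "\<theta> > 0" "q - \<theta> > 0"
    and los: "\<And>S. S \<subseteq> players n \<Longrightarrow> \<not> v S \<Longrightarrow> (\<Sum>j\<in>S. w j) < q - \<theta>"
    by (auto dest!: eventually_happens simp: algebra_simps)
  have "\<forall>\<^sub>F \<eta> in at_right 0. (\<forall>S\<in>?L. (q - \<theta> - (\<Sum>j\<in>S. w j)) + \<eta> * (- real (card S)) > 0) \<and> \<eta> > (0::real)"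
    using los by (intro eventually_conj eventually_Ball_perturb_pos eventually_at_right_less) auto
  then obtain \<eta> :: real where \<eta>: "\<eta> > 0"
    and los2: "\<And>S. S \<subseteq> players n \<Longrightarrow> \<not> v S \<Longrightarrow> (\<Sum>j\<in>S. w j) + \<eta> * card S < q - \<theta>"
    by (auto dest!: eventually_happens simp: algebra_simps)
  define u where "u j = w j + \<eta>" for j
  have sum_u: "(\<Sum>j\<in>S. u j) = (\<Sum>j\<in>S. w j) + \<eta> * card S" for S
    by (simp add: u_def sum.distrib mult_ac)
  have win: "q - \<theta> < (\<Sum>j\<in>S. u j)" if "S \<subseteq> players n" "v S" for S
  proof -
    have "\<eta> * card S \<ge> 0" using \<eta> by simp
    then show ?thesis using rep[OF that(1)] that \<theta> unfolding sum_u by linarith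
  qed
  define W where "W = (\<Sum>j\<in>players n. u j)"
  have W: "q - \<theta> < W" using win[of "players n"] simple_game_players[OF v] by (simp add: W_def)
  then have W0: "W > 0" using \<theta> by linarith
  define z where "z j = (if j = 0 then q - \<theta> else if j \<le> n then u j else 0) / W" for j
  have sum_z: "(\<Sum>j\<in>S. z j) = (\<Sum>j\<in>S. u j) / W" if "S \<subseteq> players n" for S
    unfolding sum_divide_distrib using that by (intro sum.cong) (auto simp: z_def players_def)
  have z0: "z 0 = (q - \<theta>) / W" by (simp add: z_def)
  have "strict_rep n v z"
    unfolding strict_rep_def
  proof (intro conjI allI impI)
    show "z j > 0" if "j \<le> n" for j
      using that W0 \<theta> \<eta> w[of j] by (auto simp: z_def u_def players_def add_nonneg_pos)
    show "sum z (players n) = 1"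
      using W0 by (simp add: sum_z W_def)
    show "z 0 < 1" using W W0 by (simp add: z0)
    show "if v S then z 0 < sum z S else sum z S < z 0" if "S \<subseteq> players n" for S
      using win[OF that] los2[OF that] W0
      by (simp add: sum_z[OF that] sum_u z0 divide_strict_right_mono)
  qed (simp add: z_def)
  then show ?thesis by blast
qed

text \<open>In \<open>Pr n v\<close> coordinate 0 is the quota, which does not enter the normalisation \<open>\<Sum>j. w j = 1\<close>.\<close>

definition player_ind :: "nat \<Rightarrow> real" where
  "player_ind j = (if j = 0 then 0 else 1)"

lemma sum_player_ind:
  "(\<Sum>j\<in>players n. player_ind j * z j) = (\<Sum>j\<in>players n. z j)"
  "(\<Sum>j\<le>n. player_ind j * z j) = (\<Sum>j\<in>players n. z j)"
proof -
  show *: "(\<Sum>j\<in>players n. player_ind j * z j) = (\<Sum>j\<in>players n. z j)"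
    by (intro sum.cong) (auto simp: player_ind_def players_def)
  have "(\<Sum>j\<le>n. player_ind j * z j) = (\<Sum>j\<in>players n. player_ind j * z j)"
    by (intro sum.mono_neutral_right) (auto simp: player_ind_def players_def)
  with * show "(\<Sum>j\<le>n. player_ind j * z j) = (\<Sum>j\<in>players n. z j)" by simp
qed


lemma sum_perturb:
  "(\<Sum>j\<in>S. z j + \<delta> * (y j - z j)) = (\<Sum>j\<in>S. z j) + \<delta> * ((\<Sum>j\<in>S. y j) - (\<Sum>j\<in>S. z j :: real))"
  by (simp add: sum.distrib sum_subtractf flip: sum_distrib_left)

text \<open>Finitely many strict inequalities survive a small step towards any point of the
  hyperplane.\<close>

lemma Pr_interior:
  assumes "weighted_game n v"
  shows "\<exists>z0\<in>Pr n v. \<forall>y\<in>hyperplane {..n} player_ind. \<exists>\<delta>>0. (\<lambda>j. z0 j + \<delta> * (y j - z0 j)) \<in> Pr n v"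
proof -
  obtain z where "strict_rep n v z"
    using weighted_game_strict_rep[OF assms] by blast
  then have z: "\<And>j. j > n \<Longrightarrow> z j = 0" "\<And>j. j \<le> n \<Longrightarrow> z j > 0" "z 0 < 1" "sum z (players n) = 1"
    "\<And>S. S \<subseteq> players n \<Longrightarrow> v S \<Longrightarrow> z 0 < sum z S"
    "\<And>S. S \<subseteq> players n \<Longrightarrow> \<not> v S \<Longrightarrow> sum z S < z 0"
    by (auto simp: strict_rep_def)
  show ?thesis
  proof (intro bexI[of _ z] ballI)
    show "z \<in> Pr n v"
      unfolding Pr_def mem_Collect_eq
    proof (intro conjI allI impI)
      show "z 0 \<le> sum z S" if "min_winning n v S" for S
        using z(5)[of S] that by (simp add: min_winning_def)
      show "sum z S \<le> z 0" if "max_losing n v S" for S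
        using z(6)[of S] that by (simp add: max_losing_def)
    qed (use z(1-4) in \<open>simp_all add: less_imp_le\<close>)
    fix y assume y: "y \<in> hyperplane {..n} player_ind"
    let ?W = "{S \<in> Pow (players n). v S}" and ?L = "{S \<in> Pow (players n). \<not> v S}"
    let ?s = "\<lambda>S. (\<Sum>j\<in>S. y j) - (\<Sum>j\<in>S. z j)"
    have "\<forall>\<^sub>F \<delta> in at_right 0. (\<forall>j\<in>{..n}. z j + \<delta> * (y j - z j) > 0) \<and>
        (\<forall>x\<in>{()}. (1 - z 0) + \<delta> * (z 0 - y 0) > 0) \<and>
        (\<forall>S\<in>?W. ((\<Sum>j\<in>S. z j) - z 0) + \<delta> * (?s S - (y 0 - z 0)) > 0) \<and>
        (\<forall>S\<in>?L. (z 0 - (\<Sum>j\<in>S. z j)) + \<delta> * ((y 0 - z 0) - ?s S) > 0) \<and> \<delta> > 0"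
      using z by (intro eventually_conj eventually_Ball_perturb_pos eventually_at_right_less) auto
    then obtain \<delta> where \<delta>: "\<delta> > 0" "\<And>j. j \<le> n \<Longrightarrow> z j + \<delta> * (y j - z j) > 0"
      "(1 - z 0) + \<delta> * (z 0 - y 0) > 0"
      "\<And>S. S \<in> ?W \<Longrightarrow> ((\<Sum>j\<in>S. z j) - z 0) + \<delta> * (?s S - (y 0 - z 0)) > 0"
      "\<And>S. S \<in> ?L \<Longrightarrow> (z 0 - (\<Sum>j\<in>S. z j)) + \<delta> * ((y 0 - z 0) - ?s S) > 0"
      by (auto dest!: eventually_happens)
    have "(\<lambda>j. z j + \<delta> * (y j - z j)) \<in> Pr n v"
      unfolding Pr_def sum_perturb mem_Collect_eq
    proof (intro conjI allI impI)
      show "z j + \<delta> * (y j - z j) = 0" if "j > n" for j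
        using that z(1) y by (simp add: hyperplane_def)
      show "0 \<le> z j + \<delta> * (y j - z j)" if "j \<le> n" for j
        using \<delta>(2)[OF that] by simp
      show "(\<Sum>j\<in>players n. z j) + \<delta> * ?s (players n) = 1"
        using y z(4) by (simp add: hyperplane_def sum_player_ind)
      show "z 0 + \<delta> * (y 0 - z 0) \<le> 1" using \<delta>(3) by (simp add: algebra_simps)
      show "z 0 + \<delta> * (y 0 - z 0) \<le> (\<Sum>j\<in>S. z j) + \<delta> * ?s S" if "min_winning n v S" for S
        using \<delta>(4)[of S] that by (simp add: algebra_simps min_winning_def)
      show "(\<Sum>j\<in>S. z j) + \<delta> * ?s S \<le> z 0 + \<delta> * (y 0 - z 0)" if "max_losing n v S" for S
        using \<delta>(5)[of S] that by (simp add: algebra_simps max_losing_def)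
    qed
    then show "\<exists>\<delta>>0. (\<lambda>j. z j + \<delta> * (y j - z j)) \<in> Pr n v" using \<delta>(1) by blast
  qed
qed

lemma Pr_subset_hyperplane: "Pr n v \<subseteq> hyperplane {..n} player_ind"
  by (auto simp: Pr_def hyperplane_def sum_player_ind)

lemma Pw_subset_hyperplane: "Pw n v \<subseteq> hyperplane (players n) player_ind"
  by (auto simp: Pw_def hyperplane_def sum_player_ind)

lemma zero_notin_players: "0 \<notin> players n"
  by (simp add: players_def)

lemma sum_upd_0: "S \<subseteq> players n \<Longrightarrow> sum (z(0 := a)) S = sum z S"
  using zero_notin_players[of n] by (intro sum.cong) auto

text \<open>The quota separates the weights of minimal winning and maximal losing coalitions, so
  erasing it keeps their order.\<close>

lemma Pr_imp_Pw:
  assumes "z \<in> Pr n v"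
  shows "z(0 := 0) \<in> Pw n v"
  unfolding Pw_def mem_Collect_eq
proof (intro conjI allI impI ballI)
  show "(z(0 := 0)) j = 0" if "j \<notin> players n" for j
    using that assms by (auto simp: Pr_def players_def)
  show "0 \<le> (z(0 := 0)) j" if "j \<in> players n" for j
    using that assms by (auto simp: Pr_def players_def)
  show "sum (z(0 := 0)) (players n) = 1"
    using assms by (simp only: sum_upd_0[OF order_refl]) (simp add: Pr_def)
  show "sum (z(0 := 0)) T \<le> sum (z(0 := 0)) S"
    if "min_winning n v S \<and> max_losing n v T" for S T
  proof -
    have "sum z T \<le> z 0" "z 0 \<le> sum z S" "S \<subseteq> players n" "T \<subseteq> players n"
      using that assms by (auto simp: Pr_def min_winning_def max_losing_def)
    then show ?thesis by (simp only: sum_upd_0)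
  qed
qed

lemma aff_hull_Pr:
  assumes "weighted_game n v"
  shows "aff_hull (Pr n v) = hyperplane {..n} player_ind"
  using Pr_interior[OF assms] aff_hull_eq_hyperplane[OF Pr_subset_hyperplane] by blast

text \<open>A point of the smaller hyperplane also lies in that of \<open>Pr\<close>, with quota 0;
  the perturbed point found there is projected back by erasing its quota.\<close>

lemma aff_hull_Pw:
  assumes "weighted_game n v"
  shows "aff_hull (Pw n v) = hyperplane (players n) player_ind"
proof -
  obtain z0 where z0: "z0 \<in> Pr n v"
    "\<forall>y\<in>hyperplane {..n} player_ind. \<exists>\<delta>>0. (\<lambda>j. z0 j + \<delta> * (y j - z0 j)) \<in> Pr n v"
    using Pr_interior[OF assms] ..
  show ?thesis
  proof (rule aff_hull_eq_hyperplane[OF Pw_subset_hyperplane Pr_imp_Pw[OF z0(1)]])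
    fix y assume y: "y \<in> hyperplane (players n) player_ind"
    then have "y \<in> hyperplane {..n} player_ind"
      unfolding hyperplane_def mem_Collect_eq sum_player_ind by (auto simp: players_def)
    then obtain \<delta> where \<delta>: "\<delta> > 0" "(\<lambda>j. z0 j + \<delta> * (y j - z0 j)) \<in> Pr n v" (is "?z \<in> _")
      using z0(2) by blast
    have "y 0 = 0" using y zero_notin_players by (simp add: hyperplane_def)
    then have "?z(0 := 0) = (\<lambda>j. (z0(0 := 0)) j + \<delta> * (y j - (z0(0 := 0)) j))"
      by auto
    then show "\<exists>\<delta>>0. (\<lambda>j. (z0(0 := 0)) j + \<delta> * (y j - (z0(0 := 0)) j)) \<in> Pw n v"
      using Pr_imp_Pw[OF \<delta>(2)] \<delta>(1) by metis
  qed
qed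

lemma sum_unit_vec: "finite S \<Longrightarrow> sum (unit_vec i) S = (if i \<in> S then 1 else 0)"
  by (simp add: unit_vec_def)

lemma AWI_le:
  fixes \<epsilon> :: real
  assumes v: "weighted_game n v" and i: "i \<in> players n" and \<epsilon>: "0 < \<epsilon>" "\<epsilon> < 1"
  shows "AWI n v i \<le> 1/2 + \<epsilon> + (1 - \<epsilon>) ^ (n - 1)"
proof -
  note hull = aff_hull_Pw[OF v]
  have card: "card (players n) - 1 = n - 1" by (simp add: players_def)
  have ind: "player_ind i = 1" using i by (simp add: player_ind_def players_def)
  have "poly_avg (Pw n v) (\<lambda>z. z i) \<le> 1/2 + \<epsilon> + card {unit_vec i} * (1 - \<epsilon>) ^ (n - 1)"
  proof (rule poly_avg_coordinate_le)
    show "\<exists>k g. affine_param (Pw n v) k g"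
      using hyperplane_affine_param[OF finite_players i ind hull] by blast
    show "n - 1 \<le> k" if "affine_param (Pw n v) k g" for k g
      using hyperplane_affine_param_dim[OF finite_players i ind hull that] by (simp add: card)
    have "unit_vec i j = 0" if "j \<notin> players n" for j
      using that i by (auto simp: unit_vec_def)
    then show "{unit_vec i} \<subseteq> aff_hull (Pw n v)"
      using i by (simp add: hull hyperplane_def sum_player_ind sum_unit_vec)
    fix w assume w: "w \<in> Pw n v"
    then have nn: "\<And>j. j \<in> players n \<Longrightarrow> w j \<ge> 0" and sum1: "sum w (players n) = 1"
      and ge: "\<And>S T. min_winning n v S \<Longrightarrow> max_losing n v T \<Longrightarrow> sum w T \<le> sum w S"
      by (auto simp: Pw_def)
    have ge_i: "w i \<le> sum w S" if "S \<subseteq> players n" "i \<in> S" for S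
      using that nn finite_subset[of S "players n"] by (intro member_le_sum) auto
    have le_i: "sum w S \<le> 1 - w i" if "S \<subseteq> players n" "i \<notin> S" for S
      using that i nn sum1 by (intro sum_le_complement[of "players n"]) auto
    show "0 \<le> w i \<and> w i \<le> 1" using nn i le_i[of "{}"] by simp
    assume big: "w i > 1/2 + \<epsilon>"
    define \<rho> where "\<rho> = 1 / (1 - \<epsilon>)"
    have \<rho>: "\<rho> > 0" "\<rho> * (1 - \<epsilon>) = 1" using \<epsilon> by (auto simp: \<rho>_def)
    have \<rho>_le: "\<rho> * x \<le> 1" if "x \<le> 1 - \<epsilon>" for x
      using mult_left_mono[OF that, of \<rho>] \<rho> by simp
    have "(\<lambda>j. unit_vec i j + \<rho> * (w j - unit_vec i j)) \<in> Pw n v" (is "?w \<in> _")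
      unfolding Pw_def mem_Collect_eq sum_perturb
    proof (intro conjI allI impI ballI)
      show "?w j = 0" if "j \<notin> players n" for j
        using that w i by (auto simp: Pw_def unit_vec_def)
      show "0 \<le> ?w j" if "j \<in> players n" for j
        using nn[OF that] \<rho> \<rho>_le[of "1 - w i"] big by (auto simp: unit_vec_def algebra_simps)
      show "sum (unit_vec i) (players n) + \<rho> * (sum w (players n) - sum (unit_vec i) (players n)) = 1"
        using i sum1 by (simp add: sum_unit_vec)
      fix S T assume ST: "min_winning n v S \<and> max_losing n v T"
      then have sub: "S \<subseteq> players n" "T \<subseteq> players n" by (auto simp: min_winning_def max_losing_def)
      then have fin: "finite S" "finite T" using finite_subset[OF _ finite_players] by blast+
      have le: "\<rho> * sum w T \<le> \<rho> * sum w S" using ge[of S T] ST \<rho> by simp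
      \<comment> \<open>The only case where dilation could reverse the order: here \<open>1 - sum w
        S + sum w T \<le> 2 * (1 - w i) < 1 - 2 * \<epsilon>\<close>. The case
        \<open>i \<in> T\<close>, \<open>i \<notin> S\<close> cannot occur, since \<open>T\<close>
        would weigh more than \<open>1/2\<close> and \<open>S\<close> less.\<close>
      have "\<rho> * (1 - sum w S + sum w T) \<le> 1" if "i \<in> S" "i \<notin> T"
        using ge_i[OF sub(1) that(1)] le_i[OF sub(2) that(2)] big \<epsilon> by (intro \<rho>_le) simp
      moreover have "i \<in> S" if "i \<in> T"
        using ge_i[OF sub(2) that] le_i[OF sub(1)] ge[of S T] ST big \<epsilon> by fastforce
      ultimately show "sum (unit_vec i) T + \<rho> * (sum w T - sum (unit_vec i) T)
          \<le> sum (unit_vec i) S + \<rho> * (sum w S - sum (unit_vec i) S)"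
        using le by (auto simp: sum_unit_vec fin algebra_simps)
    qed
    then show "\<exists>c\<in>{unit_vec i}. (\<lambda>j. c j + 1 / (1 - \<epsilon>) * (w j - c j)) \<in> Pw n v"
      by (simp add: \<rho>_def)
  qed (use \<epsilon> in auto)
  then show ?thesis by (simp add: AWI_def)
qed

lemma ARI_le:
  fixes \<epsilon> :: real
  assumes v: "weighted_game n v" and i: "i \<in> players n" and \<epsilon>: "0 < \<epsilon>" "\<epsilon> < 1/2"
  shows "ARI n v i \<le> 1/2 + \<epsilon> + 2 * (1 - \<epsilon>) ^ n"
proof -
  note hull = aff_hull_Pr[OF v]
  have i_le: "i \<in> {..n}" and i0: "i \<noteq> 0" using i by (auto simp: players_def)
  have ind: "player_ind i = 1" using i by (simp add: player_ind_def players_def)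
  \<comment> \<open>All weight on \<open>i\<close> and quota \<open>a\<close>. The centres
    \<open>e 0\<close> and \<open>e 1\<close> account for the factor 2 in the bound.\<close>
  define e where "e a = (unit_vec i)(0 := a)" for a :: real
  have sum_e: "sum (e a) S = (if i \<in> S then 1 else 0)" if "S \<subseteq> players n" for a S
    using sum_upd_0[OF that, of "unit_vec i" a] sum_unit_vec[of S i] finite_subset[OF that]
    by (simp add: e_def)
  have e: "e a 0 = a" "e a i = 1" "\<And>j. j \<noteq> 0 \<Longrightarrow> j \<noteq> i \<Longrightarrow> e a j = 0" for a
    using i0 by (auto simp: e_def unit_vec_def)
  have "poly_avg (Pr n v) (\<lambda>z. z i) \<le> 1/2 + \<epsilon> + card {e 0, e 1} * (1 - \<epsilon>) ^ n"
  proof (rule poly_avg_coordinate_le)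
    show "\<exists>k g. affine_param (Pr n v) k g"
      using hyperplane_affine_param[OF finite_atMost i_le ind hull] by blast
    show "n \<le> k" if "affine_param (Pr n v) k g" for k g
      using hyperplane_affine_param_dim[OF finite_atMost i_le ind hull that] by simp
    show "{e 0, e 1} \<subseteq> aff_hull (Pr n v)"
      using i i_le by (auto simp: hull hyperplane_def sum_player_ind sum_e e)
    fix z assume z: "z \<in> Pr n v"
    then have nn: "\<And>j. j \<le> n \<Longrightarrow> z j \<ge> 0" and sum1: "sum z (players n) = 1" and z0: "z 0 \<le> 1"
      and win: "\<And>S. min_winning n v S \<Longrightarrow> z 0 \<le> sum z S"
      and los: "\<And>T. max_losing n v T \<Longrightarrow> sum z T \<le> z 0"
      by (auto simp: Pr_def)
    have nn': "\<And>j. j \<in> players n \<Longrightarrow> z j \<ge> 0" using nn by (simp add: players_def)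
    have ge_i: "z i \<le> sum z S" if "S \<subseteq> players n" "i \<in> S" for S
      using that nn' finite_subset[of S "players n"] by (intro member_le_sum) auto
    have le_i: "sum z S \<le> 1 - z i" if "S \<subseteq> players n" "i \<notin> S" for S
      using that i nn' sum1 by (intro sum_le_complement[of "players n"]) auto
    show "0 \<le> z i \<and> z i \<le> 1" using nn' i le_i[of "{}"] by simp
    assume big: "z i > 1/2 + \<epsilon>"
    define \<rho> where "\<rho> = 1 / (1 - \<epsilon>)"
    have \<rho>: "\<rho> > 0" "\<rho> * (1 - \<epsilon>) = 1" using \<epsilon> by (auto simp: \<rho>_def)
    have \<rho>_le: "\<rho> * x \<le> 1" if "x \<le> 1 - \<epsilon>" for x
      using mult_left_mono[OF that, of \<rho>] \<rho> by simp
    have winD: "S \<subseteq> players n" if "min_winning n v S" for S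
      using that by (simp add: min_winning_def)
    have losD: "T \<subseteq> players n" if "max_losing n v T" for T
      using that by (simp add: max_losing_def)
    \<comment> \<open>Reduces membership of the dilated point to the constraints that involve the
      quota, which depend on the centre.\<close>
    have mem: "(\<lambda>j. e a j + \<rho> * (z j - e a j)) \<in> Pr n v"
      if q: "0 \<le> a + \<rho> * (z 0 - a)" "a + \<rho> * (z 0 - a) \<le> 1"
        and w: "\<And>S. min_winning n v S \<Longrightarrow> a + \<rho> * (z 0 - a) \<le> sum (e a) S + \<rho> * (sum z S - sum (e a) S)"
        and l: "\<And>T. max_losing n v T \<Longrightarrow> sum (e a) T + \<rho> * (sum z T - sum (e a) T) \<le> a + \<rho> * (z 0 - a)" for a
      unfolding Pr_def mem_Collect_eq sum_perturb
    proof (intro conjI allI impI ballI)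
      show "e a j + \<rho> * (z j - e a j) = 0" if "n < j" for j
        using that z i_le by (auto simp: Pr_def e)
      show "0 \<le> e a j + \<rho> * (z j - e a j)" if "j \<le> n" for j
      proof -
        consider "j = 0" | "j = i" | "j \<noteq> 0" "j \<noteq> i" by blast
        then show ?thesis
          using q(1) nn[OF that] \<rho> \<rho>_le[of "1 - z i"] big by cases (auto simp: e algebra_simps)
      qed
      show "sum (e a) (players n) + \<rho> * (sum z (players n) - sum (e a) (players n)) = 1"
        using i sum1 by (simp add: sum_e)
    qed (use q w l in \<open>auto simp: e\<close>)
    show "\<exists>c\<in>{e 0, e 1}. (\<lambda>j. c j + 1 / (1 - \<epsilon>) * (z j - c j)) \<in> Pr n v"
    proof (cases "z 0 \<ge> 1/2")
      case True
      \<comment> \<open>Without \<open>i\<close>, a coalition weighs less than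
        \<open>1/2 \<le> z 0\<close>.\<close>
      have veto: "i \<in> S" if "min_winning n v S" for S
        using win[OF that] le_i[OF winD[OF that]] True big \<epsilon> by fastforce
      \<comment> \<open>Controls both the sign of the dilated quota and the losing coalitions
        without \<open>i\<close>, whose weight is at most \<open>1 - z i\<close>.\<close>
      have bd: "\<rho> * ((1 - z i) + (1 - z 0)) \<le> 1"
        using True big by (intro \<rho>_le) simp
      have "\<rho> * (1 - z i) \<ge> 0" using \<rho> le_i[of "{}"] by simp
      have "(\<lambda>j. e 1 j + \<rho> * (z j - e 1 j)) \<in> Pr n v"
      proof (rule mem)
        show "0 \<le> 1 + \<rho> * (z 0 - 1)"
          using bd \<open>\<rho> * (1 - z i) \<ge> 0\<close> by (simp add: algebra_simps)
        show "1 + \<rho> * (z 0 - 1) \<le> 1" using z0 \<rho> by (simp add: mult_le_0_iff)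
        show "1 + \<rho> * (z 0 - 1) \<le> sum (e 1) S + \<rho> * (sum z S - sum (e 1) S)" if "min_winning n v S" for S
          using veto[OF that] win[OF that] \<rho> by (simp add: sum_e winD that)
        show "sum (e 1) T + \<rho> * (sum z T - sum (e 1) T) \<le> 1 + \<rho> * (z 0 - 1)" if T: "max_losing n v T" for T
        proof (cases "i \<in> T")
          case True
          then show ?thesis using los[OF T] \<rho> by (simp add: sum_e losD T)
        next
          case False
          then have "\<rho> * sum z T \<le> \<rho> * (1 - z i)" using le_i[OF losD[OF T]] \<rho> by simp
          then show ?thesis using False bd by (simp add: sum_e losD T algebra_simps)
        qed
      qed
      then show ?thesis by (simp add: \<rho>_def)
    next
      case False
      have pass: "i \<notin> T" if "max_losing n v T" for T
        using los[OF that] ge_i[OF losD[OF that]] False big \<epsilon> by fastforce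
      \<comment> \<open>Mirror image for small quota: bounds the dilated quota by 1 and handles the
        winning coalitions with \<open>i\<close>, whose weight is at least
        \<open>z i\<close>.\<close>
      have bd: "\<rho> * ((1 - z i) + z 0) \<le> 1"
        using False big by (intro \<rho>_le) simp
      have "\<rho> * (1 - z i) \<ge> 0" using \<rho> le_i[of "{}"] by simp
      have "(\<lambda>j. e 0 j + \<rho> * (z j - e 0 j)) \<in> Pr n v"
      proof (rule mem)
        show "0 \<le> 0 + \<rho> * (z 0 - 0)" using \<rho> nn by simp
        show "0 + \<rho> * (z 0 - 0) \<le> 1"
          using bd \<open>\<rho> * (1 - z i) \<ge> 0\<close> by (simp add: algebra_simps)
        show "sum (e 0) T + \<rho> * (sum z T - sum (e 0) T) \<le> 0 + \<rho> * (z 0 - 0)" if "max_losing n v T" for T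
          using pass[OF that] los[OF that] \<rho> by (simp add: sum_e losD that)
        show "0 + \<rho> * (z 0 - 0) \<le> sum (e 0) S + \<rho> * (sum z S - sum (e 0) S)" if S: "min_winning n v S" for S
        proof (cases "i \<in> S")
          case True
          then have "\<rho> * z i \<le> \<rho> * sum z S" using ge_i[OF winD[OF S]] \<rho> by simp
          then show ?thesis using True bd by (simp add: sum_e winD S algebra_simps)
        next
          case False
          then show ?thesis using win[OF S] \<rho> by (simp add: sum_e winD S)
        qed
      qed
      then show ?thesis by (simp add: \<rho>_def)
    qed
  qed (use \<epsilon> in auto)
  also have "\<dots> \<le> 1/2 + \<epsilon> + 2 * (1 - \<epsilon>) ^ n"
  proof -
    have "card {e 0, e 1} \<le> 2" by (simp add: card_insert_if)
    then have "real (card {e 0, e 1}) * (1 - \<epsilon>) ^ n \<le> 2 * (1 - \<epsilon>) ^ n"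
      using \<epsilon> by (intro mult_right_mono) auto
    then show ?thesis by simp
  qed
  finally show ?thesis by (simp add: ARI_def)
qed

section \<open>Large numbers of players and the combined statement\<close>

lemma eventually_half_plus_eps:
  fixes \<epsilon> :: real
  assumes "\<epsilon> > 0"
  obtains \<delta> N where "0 < \<delta>" "\<delta> < 1/2" "\<And>m. m \<ge> N \<Longrightarrow> 1/2 + \<delta> + 2 * (1 - \<delta>) ^ m \<le> 1/2 + \<epsilon>"
proof -
  \<comment> \<open>One half of \<open>\<epsilon>\<close> pays for \<open>\<delta>\<close>, the
    other for \<open>2 * (1 - \<delta>) ^ m\<close>; the cap \<open>1/4\<close> ensures
    \<open>\<delta> < 1/2\<close>, as \<open>ARI_le\<close> requires.\<close>
  define \<delta> where "\<delta> = min (\<epsilon> / 2) (1/4)"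
  have \<delta>: "0 < \<delta>" "\<delta> < 1/2" "\<delta> \<le> \<epsilon> / 2" using assms by (auto simp: \<delta>_def)
  have "(\<lambda>m. (1 - \<delta>) ^ m) \<longlonglongrightarrow> 0" using \<delta> by (intro LIMSEQ_realpow_zero) auto
  then have "\<forall>\<^sub>F m in sequentially. (1 - \<delta>) ^ m < \<epsilon> / 4"
    by (rule order_tendstoD) (use assms in simp)
  then obtain N where "\<And>m. m \<ge> N \<Longrightarrow> (1 - \<delta>) ^ m < \<epsilon> / 4"
    by (auto simp: eventually_sequentially)
  with \<delta> that[of \<delta> N] show thesis by fastforce
qed

theorem AWI_bound:
  assumes "(\<epsilon>::real) > 0"
  shows "\<exists>N. \<forall>n\<ge>N. \<forall>v. weighted_game n v \<longrightarrow> (\<forall>i\<in>players n. AWI n v i \<le> 1/2 + \<epsilon>)"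
proof -
  obtain \<delta> N where \<delta>: "0 < \<delta>" "\<delta> < 1/2"
    and N: "\<And>m. m \<ge> N \<Longrightarrow> 1/2 + \<delta> + 2 * (1 - \<delta>) ^ m \<le> 1/2 + \<epsilon>"
    using eventually_half_plus_eps[OF assms] by blast
  show ?thesis
  \<comment> \<open>The shift by one matches the exponent \<open>n - 1\<close> in
    \<open>AWI_le\<close>.\<close>
  proof (intro exI[of _ "Suc N"] allI impI ballI)
    fix n v i assume n: "Suc N \<le> n" "weighted_game n v" "i \<in> players n"
    have "(1 - \<delta>) ^ (n - 1) \<ge> 0" using \<delta> by simp
    then show "AWI n v i \<le> 1/2 + \<epsilon>"
      using AWI_le[of n v i \<delta>] n \<delta> N[of "n - 1"] by linarith
  qed
qed

theorem ARI_bound: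
  assumes "(\<epsilon>::real) > 0"
  shows "\<exists>N. \<forall>n\<ge>N. \<forall>v. weighted_game n v \<longrightarrow> (\<forall>i\<in>players n. ARI n v i \<le> 1/2 + \<epsilon>)"
proof -
  obtain \<delta> N where \<delta>: "0 < \<delta>" "\<delta> < 1/2"
    and N: "\<And>m. m \<ge> N \<Longrightarrow> 1/2 + \<delta> + 2 * (1 - \<delta>) ^ m \<le> 1/2 + \<epsilon>"
    using eventually_half_plus_eps[OF assms] by blast
  show ?thesis
    using ARI_le[OF _ _ \<delta>] N by (intro exI[of _ N]) (meson order_trans)
qed

theorem theorem8:
  shows
  "(\<forall>n v. simple_game n v \<longrightarrow> (\<forall>i\<in>players n. PGI n v i = 1 \<or> PGI n v i \<le> 1/2)) \<and>
   (\<forall>n v. simple_game n v \<longrightarrow> (\<forall>i\<in>players n. DP n v i = 1 \<or> DP n v i \<le> 1/2)) \<and>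
   (\<forall>n v. simple_game n v \<longrightarrow> (\<forall>i\<in>players n. Nuc n v i = 1 \<or> Nuc n v i \<le> 1/2)) \<and>
   (\<forall>n v. weighted_game n v \<longrightarrow> (\<forall>i\<in>players n. MSRI n v i = 1 \<or> MSRI n v i \<le> 1/2)) \<and>
   (\<forall>\<epsilon>::real. \<epsilon> > 0 \<longrightarrow> (\<exists>N::nat. \<forall>n\<ge>N. \<forall>v. weighted_game n v \<longrightarrow>
        (\<forall>i\<in>players n. AWI n v i = 1 \<or> AWI n v i \<le> 1/2 + \<epsilon>))) \<and>
   (\<forall>\<epsilon>::real. \<epsilon> > 0 \<longrightarrow> (\<exists>N::nat. \<forall>n\<ge>N. \<forall>v. weighted_game n v \<longrightarrow>
        (\<forall>i\<in>players n. ARI n v i = 1 \<or> ARI n v i \<le> 1/2 + \<epsilon>)))"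
proof (intro conjI allI impI ballI)
  show "PGI n v i = 1 \<or> PGI n v i \<le> 1/2" if "simple_game n v" for n v i
    using that by (rule PGI_bound)
  show "DP n v i = 1 \<or> DP n v i \<le> 1/2" if "simple_game n v" for n v i
    using that by (rule DP_bound)
  show "Nuc n v i = 1 \<or> Nuc n v i \<le> 1/2" if "simple_game n v" "i \<in> players n" for n v i
    using that by (rule Nuc_bound)
  show "MSRI n v i = 1 \<or> MSRI n v i \<le> 1/2" if "weighted_game n v" "i \<in> players n" for n v i
    using that by (intro MSRI_bound) (simp_all add: weighted_game_def)
  show "\<exists>N::nat. \<forall>n\<ge>N. \<forall>v. weighted_game n v \<longrightarrow>
      (\<forall>i\<in>players n. AWI n v i = 1 \<or> AWI n v i \<le> 1/2 + \<epsilon>)" if "\<epsilon> > 0" for \<epsilon> :: real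
    using AWI_bound[OF that] by blast
  show "\<exists>N::nat. \<forall>n\<ge>N. \<forall>v. weighted_game n v \<longrightarrow>
      (\<forall>i\<in>players n. ARI n v i = 1 \<or> ARI n v i \<le> 1/2 + \<epsilon>)" if "\<epsilon> > 0" for \<epsilon> :: real
    using ARI_bound[OF that] by blast
qed

end
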